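(* Let $\Delta\ge 1$, $\varepsilon>0$, and let $(G=(V,E),\mathcal L)$ be a $((1+\varepsilon)\Delta+1)$-extra list edge coloring instance where $G$ has maximum degree at most $\Delta$, and let $\mu$ be the uniform distribution on its proper edge colorings. Then for every edge $i\in E$ and all colors $a,b\in\mathcal L(i)$, \[\mathcal W_1\big(\mu_E^{i\leftarrow a},\mu_E^{i\leftarrow b}\big)\le 1+\frac{2}{\varepsilon},\] i.e. $\mu$ is $(1+2/\varepsilon)$-coupling independent in this sense.
   Context: A list edge coloring instance is a pair $(G,\mathcal L)$, $G=(V,E)$ a finite undirected graph, $\mathcal L(e)\subseteq[q]$ a color list for each $e\in E$. For $e\in E$, $\deg(e)$ is the number of edges other than $e$ sharing an endpoint with $e$. A proper edge coloring is $\sigma:E\to[q]$ with $\sigma(e)\in\mathcal L(e)$ and $\sigma(e_1)\neq\sigma(e_2)$ for distinct edges sharing an endpoint. The instance is $\beta$-extra if $|\mathcal L(e)|\ge\deg(e)+\beta$ for all $e$. For a pinning $i\leftarrow c$, $\mu^{i\leftarrow c}$ denotes $\mu$ conditioned on edge $i$ receiving color $c$, and $\mu^{i\leftarrow c}_S$ its marginal on the edge set $S$. For distributions $\nu_1,\nu_2$ on a finite set with metric $d$, $\mathcal W_1(\nu_1,\nu_2)=\inf_{\omega}\mathbb E_{(x,y)\sim\omega}[d(x,y)]$ over all couplings $\omega$ of $\nu_1,\nu_2$; here $d$ is the Hamming distance (number of edges colored differently). *)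

theory Defs
  imports "HOL-Probability.Probability" "HOL-Library.FuncSet"
begin

definition finite_graph :: "'v set \<Rightarrow> 'v set set \<Rightarrow> bool" where
  "finite_graph V E \<longleftrightarrow> finite V \<and> (\<forall>e\<in>E. e \<subseteq> V \<and> card e = 2)"

definition vertex_degree :: "'v set set \<Rightarrow> 'v \<Rightarrow> nat" where
  "vertex_degree E v = card {e \<in> E. v \<in> e}"

definition edge_degree :: "'v set set \<Rightarrow> 'v set \<Rightarrow> nat" where
  "edge_degree E e = card {f \<in> E. f \<noteq> e \<and> f \<inter> e \<noteq> {}}"

definition list_edge_coloring_instance ::
    "'v set \<Rightarrow> 'v set set \<Rightarrow> nat \<Rightarrow> ('v set \<Rightarrow> nat set) \<Rightarrow> bool" where
  "list_edge_coloring_instance V E q L \<longleftrightarrow> finite_graph V E \<and> (\<forall>e\<in>E. L e \<subseteq> {1..q})"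

definition extra :: "real \<Rightarrow> 'v set set \<Rightarrow> ('v set \<Rightarrow> nat set) \<Rightarrow> bool" where
  "extra \<beta> E L \<longleftrightarrow> (\<forall>e\<in>E. real (card (L e)) \<ge> real (edge_degree E e) + \<beta>)"

text \<open>Colorings are extensional functions, so that each map from \<open>E\<close> to \<open>[q]\<close> is
  represented exactly once and the uniform distribution below is the intended one.\<close>

definition proper_edge_colorings ::
    "'v set set \<Rightarrow> nat \<Rightarrow> ('v set \<Rightarrow> nat set) \<Rightarrow> ('v set \<Rightarrow> nat) set" where
  "proper_edge_colorings E q L =
     {\<sigma> \<in> E \<rightarrow>\<^sub>E {1..q}. (\<forall>e\<in>E. \<sigma> e \<in> L e) \<and>
        (\<forall>e\<in>E. \<forall>f\<in>E. e \<noteq> f \<and> e \<inter> f \<noteq> {} \<longrightarrow> \<sigma> e \<noteq> \<sigma> f)}"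

definition uniform_edge_coloring ::
    "'v set set \<Rightarrow> nat \<Rightarrow> ('v set \<Rightarrow> nat set) \<Rightarrow> ('v set \<Rightarrow> nat) pmf" where
  "uniform_edge_coloring E q L = pmf_of_set (proper_edge_colorings E q L)"

definition pinned :: "('e \<Rightarrow> 'c) pmf \<Rightarrow> 'e \<Rightarrow> 'c \<Rightarrow> ('e \<Rightarrow> 'c) pmf" where
  "pinned \<mu> i c = cond_pmf \<mu> {\<sigma>. \<sigma> i = c}"

definition marginal :: "('e \<Rightarrow> 'c) pmf \<Rightarrow> 'e set \<Rightarrow> ('e \<Rightarrow> 'c) pmf" where
  "marginal \<mu> S = map_pmf (\<lambda>\<sigma>. restrict \<sigma> S) \<mu>"

definition couplings :: "'a pmf \<Rightarrow> 'a pmf \<Rightarrow> ('a \<times> 'a) pmf set" where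
  "couplings \<nu>\<^sub>1 \<nu>\<^sub>2 = {\<omega>. map_pmf fst \<omega> = \<nu>\<^sub>1 \<and> map_pmf snd \<omega> = \<nu>\<^sub>2}"

definition wasserstein1 :: "('a \<Rightarrow> 'a \<Rightarrow> real) \<Rightarrow> 'a pmf \<Rightarrow> 'a pmf \<Rightarrow> real" where
  "wasserstein1 d \<nu>\<^sub>1 \<nu>\<^sub>2 =
     (INF \<omega>\<in>couplings \<nu>\<^sub>1 \<nu>\<^sub>2. measure_pmf.expectation \<omega> (\<lambda>(x, y). d x y))"

definition hamming :: "'e set \<Rightarrow> ('e \<Rightarrow> 'c) \<Rightarrow> ('e \<Rightarrow> 'c) \<Rightarrow> real" where
  "hamming S x y = real (card {e \<in> S. x e \<noteq> y e})"

end

theory Submission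
  imports Defs
begin

text \<open>
  Write \<open>D = 1 / \<epsilon>\<close> and \<open>C = 1 + 2 * D\<close>. The heart is a one-vertex estimate, proved by induction on
  the number of edges: if deleting the color \<open>a\<close> from the lists at a vertex \<open>u\<close>, and likewise deleting
  \<open>b\<close>, leaves the instance \<open>((1 + \<epsilon>) * \<Delta> + 1)\<close>-extra, then the two uniform distributions \<open>X\<close> and \<open>Y\<close> are at
  distance at most \<open>D\<close>. Pinning an edge \<open>{u, w}\<close> to one of two colors is the same as deleting the
  edge and one of the two colors at \<open>u\<close> and at \<open>w\<close>, so that it costs \<open>1 + D + D = C\<close>.

  For the estimate let \<open>Z\<close> be the colorings avoiding both colors at \<open>u\<close>, and for an edge \<open>e\<close> at \<open>u\<close> let
  \<open>X\<^sub>e\<close> (resp. \<open>Y\<^sub>e\<close>) be those of \<open>X\<close> (resp. \<open>Y\<close>) in which \<open>e\<close> has color \<open>b\<close> (resp. \<open>a\<close>). Since \<open>b\<close> occurs at most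
  once at \<open>u\<close>, \<open>X\<close> is the disjoint union of \<open>Z\<close> and the \<open>X\<^sub>e\<close>, and recoloring \<open>e\<close> shows
  \<open>(1 + \<epsilon>) * \<Delta> * |X\<^sub>e| \<le> |Z|\<close>. Move mass \<open>|Z|\<close> identically, \<open>min |X\<^sub>e| |Y\<^sub>e|\<close> from \<open>X\<^sub>e\<close> to \<open>Y\<^sub>e\<close>, and the
  excess of \<open>|X\<^sub>e|\<close> over \<open>|Y\<^sub>e|\<close> from \<open>X\<^sub>e\<close> to all of \<open>Y\<close> (or the excess of \<open>|Y\<^sub>e|\<close> from all of \<open>X\<close> to \<open>Y\<^sub>e\<close>). The
  marginals are proportional to \<open>X\<close> and \<open>Y\<close>, each non-identical move costs at most \<open>C\<close> by induction,
  and these moves carry at most the fraction \<open>1 / (2 + \<epsilon>)\<close> of the mass: \<open>C / (2 + \<epsilon>) = D\<close>.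
\<close>

section \<open>Transport plans with finite support\<close>

text \<open>Weights are real functions of arbitrary total mass, so that plans between pieces of
  different size can be scaled and added. The bound \<open>K\<close> on the cost stands in for an
  infimum over plans.\<close>

definition transport :: "('a \<Rightarrow> 'a \<Rightarrow> real) \<Rightarrow> 'a set \<Rightarrow> ('a \<Rightarrow> real) \<Rightarrow> ('a \<Rightarrow> real) \<Rightarrow> real \<Rightarrow> bool" where
  "transport d S f g K \<longleftrightarrow> (\<exists>w. (\<forall>x y. 0 \<le> w x y) \<and> (\<forall>x\<in>S. (\<Sum>y\<in>S. w x y) = f x) \<and>
     (\<forall>y\<in>S. (\<Sum>x\<in>S. w x y) = g y) \<and> (\<Sum>x\<in>S. \<Sum>y\<in>S. w x y * d x y) \<le> K)"

definition unif :: "'a set \<Rightarrow> 'a \<Rightarrow> real" where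
  "unif A x = indicator A x / real (card A)"

lemma transportI:
  assumes "\<And>x y. 0 \<le> w x y" "\<And>x. x \<in> S \<Longrightarrow> (\<Sum>y\<in>S. w x y) = f x"
    "\<And>y. y \<in> S \<Longrightarrow> (\<Sum>x\<in>S. w x y) = g y" "(\<Sum>x\<in>S. \<Sum>y\<in>S. w x y * d x y) \<le> K"
  shows "transport d S f g K"
  unfolding transport_def using assms by blast

lemma transportE:
  assumes "transport d S f g K"
  obtains w where "\<And>x y. 0 \<le> w x y" "\<And>x. x \<in> S \<Longrightarrow> (\<Sum>y\<in>S. w x y) = f x"
    "\<And>y. y \<in> S \<Longrightarrow> (\<Sum>x\<in>S. w x y) = g y" "(\<Sum>x\<in>S. \<Sum>y\<in>S. w x y * d x y) \<le> K"
  using assms unfolding transport_def by blast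

lemma transport_mono: "transport d S f g K \<Longrightarrow> K \<le> K' \<Longrightarrow> transport d S f g K'"
  unfolding transport_def by (meson order_trans)

lemma transport_refl:
  assumes "finite S" "\<And>x. 0 \<le> f x" "\<And>x. d x x = 0"
  shows "transport d S f f 0"
proof (rule transportI[where w = "\<lambda>x y. if x = y then f x else 0"])
  have zero: "(if x = y then f x else 0) * d x y = 0" for x y
    using assms(3) by simp
  show "(\<Sum>x\<in>S. \<Sum>y\<in>S. (if x = y then f x else 0) * d x y) \<le> 0"
    by (simp only: zero sum.neutral_const order_refl)
qed (use assms in \<open>auto simp: sum.delta sum.delta'\<close>)

lemma transport_sym:
  assumes "transport d S f g K" "\<And>x y. d x y = d y x"
  shows "transport d S g f K"
proof -
  obtain w where w: "\<And>x y. 0 \<le> w x y" "\<And>x. x \<in> S \<Longrightarrow> (\<Sum>y\<in>S. w x y) = f x"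
    "\<And>y. y \<in> S \<Longrightarrow> (\<Sum>x\<in>S. w x y) = g y" "(\<Sum>x\<in>S. \<Sum>y\<in>S. w x y * d x y) \<le> K"
    using assms(1) by (rule transportE) blast
  have "(\<Sum>x\<in>S. \<Sum>y\<in>S. w y x * d x y) = (\<Sum>x\<in>S. \<Sum>y\<in>S. w x y * d x y)"
    by (subst sum.swap) (simp add: assms(2))
  with w show ?thesis
    by (intro transportI[where w = "\<lambda>x y. w y x"]) auto
qed

text \<open>A plan is demanded only for \<open>0 < c\<close>: a piece of mass 0 may come from an
  empty set, whose \<open>unif\<close> is the zero function and admits no plan to a probability
  distribution.\<close>

lemma transport_scale:
  assumes "0 \<le> c" "0 < c \<Longrightarrow> transport d S f g K"
  shows "transport d S (\<lambda>x. c * f x) (\<lambda>x. c * g x) (c * K)"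
proof (cases "c = 0")
  case True
  then show ?thesis by (intro transportI[where w = "\<lambda>_ _. 0"]) auto
next
  case False
  with assms(1) have "0 < c" by simp
  from assms(2)[OF this] obtain w where w: "\<And>x y. 0 \<le> w x y" "\<And>x. x \<in> S \<Longrightarrow> (\<Sum>y\<in>S. w x y) = f x"
    "\<And>y. y \<in> S \<Longrightarrow> (\<Sum>x\<in>S. w x y) = g y" "(\<Sum>x\<in>S. \<Sum>y\<in>S. w x y * d x y) \<le> K"
    by (rule transportE) blast
  have "(\<Sum>x\<in>S. \<Sum>y\<in>S. c * w x y * d x y) = c * (\<Sum>x\<in>S. \<Sum>y\<in>S. w x y * d x y)"
    by (simp add: sum_distrib_left mult.assoc)
  also have "\<dots> \<le> c * K"
    using w(4) assms(1) by (rule mult_left_mono)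
  finally show ?thesis
    using w assms(1)
    by (intro transportI[where w = "\<lambda>x y. c * w x y"]) (auto simp: sum_distrib_left[symmetric])
qed

lemma transport_add:
  assumes "transport d S f g K" "transport d S f' g' K'"
  shows "transport d S (\<lambda>x. f x + f' x) (\<lambda>x. g x + g' x) (K + K')"
proof -
  obtain w where w: "\<And>x y. 0 \<le> w x y" "\<And>x. x \<in> S \<Longrightarrow> (\<Sum>y\<in>S. w x y) = f x"
    "\<And>y. y \<in> S \<Longrightarrow> (\<Sum>x\<in>S. w x y) = g y" "(\<Sum>x\<in>S. \<Sum>y\<in>S. w x y * d x y) \<le> K"
    using assms(1) by (rule transportE) blast
  obtain v where v: "\<And>x y. 0 \<le> v x y" "\<And>x. x \<in> S \<Longrightarrow> (\<Sum>y\<in>S. v x y) = f' x"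
    "\<And>y. y \<in> S \<Longrightarrow> (\<Sum>x\<in>S. v x y) = g' y" "(\<Sum>x\<in>S. \<Sum>y\<in>S. v x y * d x y) \<le> K'"
    using assms(2) by (rule transportE) blast
  show ?thesis
    using w v by (intro transportI[where w = "\<lambda>x y. w x y + v x y"])
      (auto simp: sum.distrib distrib_right)
qed

lemma transport_sum:
  assumes "finite I" "\<And>i. i \<in> I \<Longrightarrow> transport d S (f i) (g i) (K i)"
  shows "transport d S (\<lambda>x. \<Sum>i\<in>I. f i x) (\<lambda>x. \<Sum>i\<in>I. g i x) (\<Sum>i\<in>I. K i)"
  using assms
proof (induction I rule: finite_induct)
  case empty
  then show ?case by (intro transportI[where w = "\<lambda>_ _. 0"]) auto
next
  case (insert i I)
  then show ?case by (auto intro!: transport_add)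
qed

text \<open>The mass of \<open>f\<close> is divided in the proportions \<open>c i\<close>, and share
  \<open>i\<close> follows the plan to \<open>g i\<close>; the costs average to
  \<open>K\<close>.\<close>

lemma transport_mixture_right:
  assumes "finite I" "\<And>i. i \<in> I \<Longrightarrow> 0 \<le> c i" "(\<Sum>i\<in>I. c i) = 1"
    and "\<And>i. i \<in> I \<Longrightarrow> 0 < c i \<Longrightarrow> transport d S f (g i) K"
  shows "transport d S f (\<lambda>x. \<Sum>i\<in>I. c i * g i x) K"
proof -
  have "transport d S (\<lambda>x. \<Sum>i\<in>I. c i * f x) (\<lambda>x. \<Sum>i\<in>I. c i * g i x) (\<Sum>i\<in>I. c i * K)"
    by (rule transport_sum[OF assms(1)], rule transport_scale) (use assms in auto)
  then show ?thesis
    by (simp add: sum_distrib_right[symmetric] assms(3))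
qed

text \<open>Gluing of plans: the middle point is distributed as \<open>g\<close>, and given it the
  two ends are chosen independently according to the two plans.\<close>

lemma transport_trans:
  assumes S: "finite S" and fg: "transport d S f g K" and gh: "transport d S g h K'"
    and d: "\<And>x y z. d x z \<le> d x y + d y z"
  shows "transport d S f h (K + K')"
proof -
  obtain w where w: "\<And>x y. 0 \<le> w x y" "\<And>x. x \<in> S \<Longrightarrow> (\<Sum>y\<in>S. w x y) = f x"
    "\<And>y. y \<in> S \<Longrightarrow> (\<Sum>x\<in>S. w x y) = g y" "(\<Sum>x\<in>S. \<Sum>y\<in>S. w x y * d x y) \<le> K"
    using fg by (rule transportE) blast
  obtain v where v: "\<And>x y. 0 \<le> v x y" "\<And>x. x \<in> S \<Longrightarrow> (\<Sum>y\<in>S. v x y) = g x"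
    "\<And>y. y \<in> S \<Longrightarrow> (\<Sum>x\<in>S. v x y) = h y" "(\<Sum>x\<in>S. \<Sum>y\<in>S. v x y * d x y) \<le> K'"
    using gh by (rule transportE) blast
  \<comment> \<open>Points of \<open>g\<close>-mass 0 carry no weight in either plan, so the
    convention that division by 0 gives 0 yields the right value there.\<close>
  have w0: "w x y = 0" if "x \<in> S" "y \<in> S" "g y = 0" for x y
    using w(3)[OF that(2)] that S w(1) by (simp add: sum_nonneg_eq_0_iff)
  have v0: "v y z = 0" if "y \<in> S" "z \<in> S" "g y = 0" for y z
    using v(2)[OF that(1)] that S v(1) by (simp add: sum_nonneg_eq_0_iff)
  have g0: "0 \<le> g y" if "y \<in> S" for y
    using w(3)[OF that] w(1) by (metis sum_nonneg)
  define u where "u x z = (\<Sum>y\<in>S. w x y * v y z / g y)" for x z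
  have wz: "(\<Sum>z\<in>S. w x y * v y z / g y) = w x y" if "x \<in> S" "y \<in> S" for x y
    using w0[OF that] v(2)[OF that(2)]
    by (cases "g y = 0") (simp_all add: sum_divide_distrib[symmetric] sum_distrib_left[symmetric])
  have vx: "(\<Sum>x\<in>S. w x y * v y z / g y) = v y z" if "y \<in> S" "z \<in> S" for y z
    using v0[OF that] w(3)[OF that(1)]
    by (cases "g y = 0") (simp_all add: sum_divide_distrib[symmetric] sum_distrib_right[symmetric])
  show ?thesis
  proof (rule transportI[where w = u])
    show "0 \<le> u x z" for x z
      unfolding u_def using w(1) v(1) g0 by (intro sum_nonneg) auto
  next
    fix x assume "x \<in> S"
    have "(\<Sum>z\<in>S. u x z) = (\<Sum>y\<in>S. \<Sum>z\<in>S. w x y * v y z / g y)"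
      unfolding u_def by (rule sum.swap)
    also have "\<dots> = f x" using wz \<open>x \<in> S\<close> w(2) by simp
    finally show "(\<Sum>z\<in>S. u x z) = f x" .
  next
    fix z assume "z \<in> S"
    have "(\<Sum>x\<in>S. u x z) = (\<Sum>y\<in>S. \<Sum>x\<in>S. w x y * v y z / g y)"
      unfolding u_def by (rule sum.swap)
    also have "\<dots> = h z" using vx \<open>z \<in> S\<close> v(3) by simp
    finally show "(\<Sum>x\<in>S. u x z) = h z" .
  next
    have "(\<Sum>x\<in>S. \<Sum>z\<in>S. u x z * d x z) = (\<Sum>x\<in>S. \<Sum>z\<in>S. \<Sum>y\<in>S. w x y * v y z / g y * d x z)"
      by (simp add: u_def sum_distrib_right)
    also have "\<dots> \<le> (\<Sum>x\<in>S. \<Sum>z\<in>S. \<Sum>y\<in>S. w x y * v y z / g y * (d x y + d y z))"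
      using w(1) v(1) g0 d by (intro sum_mono mult_left_mono) auto
    also have "\<dots> = (\<Sum>x\<in>S. \<Sum>z\<in>S. \<Sum>y\<in>S. w x y * v y z / g y * d x y) +
        (\<Sum>x\<in>S. \<Sum>z\<in>S. \<Sum>y\<in>S. w x y * v y z / g y * d y z)"
      by (simp add: distrib_left sum.distrib)
    also have "(\<Sum>x\<in>S. \<Sum>z\<in>S. \<Sum>y\<in>S. w x y * v y z / g y * d x y) =
        (\<Sum>x\<in>S. \<Sum>y\<in>S. (\<Sum>z\<in>S. w x y * v y z / g y) * d x y)"
      unfolding sum_distrib_right by (intro sum.cong refl sum.swap)
    also have "\<dots> = (\<Sum>x\<in>S. \<Sum>y\<in>S. w x y * d x y)"
      using wz by (intro sum.cong refl) simp
    also have "(\<Sum>x\<in>S. \<Sum>z\<in>S. \<Sum>y\<in>S. w x y * v y z / g y * d y z) =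
        (\<Sum>z\<in>S. \<Sum>y\<in>S. \<Sum>x\<in>S. w x y * v y z / g y * d y z)"
      by (subst sum.swap) (intro sum.cong refl sum.swap)
    also have "\<dots> = (\<Sum>y\<in>S. \<Sum>z\<in>S. (\<Sum>x\<in>S. w x y * v y z / g y) * d y z)"
      unfolding sum_distrib_right by (rule sum.swap)
    also have "\<dots> = (\<Sum>y\<in>S. \<Sum>z\<in>S. v y z * d y z)"
      using vx by (intro sum.cong refl) simp
    finally show "(\<Sum>x\<in>S. \<Sum>z\<in>S. u x z * d x z) \<le> K + K'"
      using w(4) v(4) by linarith
  qed
qed

section \<open>Uniform weights and their images under injections\<close>

lemma sum_unif:
  assumes "finite S" "A \<subseteq> S" "A \<noteq> {}"
  shows "(\<Sum>x\<in>S. unif A x) = 1"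
proof -
  have "finite A" using assms finite_subset by blast
  then show ?thesis
    using assms by (simp add: unif_def sum_divide_distrib[symmetric] indicator_def sum.If_cases Int_absorb1)
qed

lemma unif_image:
  assumes "finite S" "A \<subseteq> S" "inj_on \<phi> S"
  shows "(\<Sum>x\<in>S. if \<phi> x = y then unif A x else 0) = unif (\<phi> ` A) y"
proof -
  have card: "card (\<phi> ` A) = card A"
    using assms by (intro card_image) (blast intro: inj_on_subset)
  show ?thesis
  proof (cases "y \<in> \<phi> ` S")
    case True
    then obtain x where x: "x \<in> S" "y = \<phi> x" by blast
    have "(\<Sum>x'\<in>S. if \<phi> x' = y then unif A x' else 0) = (\<Sum>x'\<in>S. if x' = x then unif A x' else 0)"
      using x assms(3) by (intro sum.cong refl) (auto dest: inj_onD)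
    also have "\<dots> = unif A x"
      using x assms(1) by simp
    also have "\<dots> = unif (\<phi> ` A) y"
      using x assms by (auto simp: unif_def card indicator_def dest: inj_onD)
    finally show ?thesis .
  next
    case False
    then have "(\<Sum>x\<in>S. if \<phi> x = y then unif A x else 0) = 0"
      by (intro sum.neutral) auto
    moreover have "y \<notin> \<phi> ` A" using False assms(2) by blast
    ultimately show ?thesis by (simp add: unif_def)
  qed
qed

text \<open>The plan is pushed forward by \<open>\<phi>\<close> on the left and
  \<open>\<psi>\<close> on the right. Its total mass is 1, so an increase of at most
  \<open>k\<close> in each distance raises the cost by at most \<open>k\<close>. With
  \<open>k = 1\<close> this puts a pinned edge back.\<close>

lemma transport_push:
  assumes fin: "finite S" "finite S'" and AB: "A \<subseteq> S" "B \<subseteq> S" "A \<noteq> {}"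
    and maps: "\<phi> ` S \<subseteq> S'" "\<psi> ` S \<subseteq> S'" "inj_on \<phi> S" "inj_on \<psi> S"
    and tr: "transport d S (unif A) (unif B) K"
    and d: "\<And>x y. x \<in> S \<Longrightarrow> y \<in> S \<Longrightarrow> d' (\<phi> x) (\<psi> y) \<le> d x y + k"
  shows "transport d' S' (unif (\<phi> ` A)) (unif (\<psi> ` B)) (K + k)"
proof -
  obtain w where w: "\<And>x y. 0 \<le> w x y" "\<And>x. x \<in> S \<Longrightarrow> (\<Sum>y\<in>S. w x y) = unif A x"
    "\<And>y. y \<in> S \<Longrightarrow> (\<Sum>x\<in>S. w x y) = unif B y" "(\<Sum>x\<in>S. \<Sum>y\<in>S. w x y * d x y) \<le> K"
    using tr by (rule transportE) blast
  define v where "v x' y' = (\<Sum>x\<in>S. \<Sum>y\<in>S. if \<phi> x = x' \<and> \<psi> y = y' then w x y else 0)" for x' y'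
  show ?thesis
  proof (rule transportI[where w = v])
    show "0 \<le> v x y" for x y
      unfolding v_def using w(1) by (intro sum_nonneg) auto
  next
    fix x' assume "x' \<in> S'"
    have "(\<Sum>y'\<in>S'. v x' y') =
        (\<Sum>x\<in>S. \<Sum>y\<in>S. \<Sum>y'\<in>S'. if \<phi> x = x' \<and> \<psi> y = y' then w x y else 0)"
      unfolding v_def by (subst sum.swap, intro sum.cong refl, rule sum.swap)
    also have "\<dots> = (\<Sum>x\<in>S. \<Sum>y\<in>S. if \<phi> x = x' then w x y else 0)"
      using maps(2) fin by (intro sum.cong refl) auto
    also have "\<dots> = (\<Sum>x\<in>S. if \<phi> x = x' then unif A x else 0)"
      using w(2) by (intro sum.cong refl) auto
    also have "\<dots> = unif (\<phi> ` A) x'"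
      using fin AB maps by (intro unif_image)
    finally show "(\<Sum>y'\<in>S'. v x' y') = unif (\<phi> ` A) x'" .
  next
    fix y' assume "y' \<in> S'"
    have "(\<Sum>x'\<in>S'. v x' y') =
        (\<Sum>x\<in>S. \<Sum>y\<in>S. \<Sum>x'\<in>S'. if \<phi> x = x' \<and> \<psi> y = y' then w x y else 0)"
      unfolding v_def by (subst sum.swap, intro sum.cong refl, rule sum.swap)
    also have "\<dots> = (\<Sum>x\<in>S. \<Sum>y\<in>S. if \<psi> y = y' then w x y else 0)"
      using maps(1) fin by (intro sum.cong refl) auto
    also have "\<dots> = (\<Sum>y\<in>S. \<Sum>x\<in>S. if \<psi> y = y' then w x y else 0)"
      by (rule sum.swap)
    also have "\<dots> = (\<Sum>y\<in>S. if \<psi> y = y' then unif B y else 0)"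
      using w(3) by (intro sum.cong refl) auto
    also have "\<dots> = unif (\<psi> ` B) y'"
      using fin AB maps by (intro unif_image)
    finally show "(\<Sum>x'\<in>S'. v x' y') = unif (\<psi> ` B) y'" .
  next
    have "(\<Sum>x'\<in>S'. \<Sum>y'\<in>S'. v x' y' * d' x' y') =
        (\<Sum>x'\<in>S'. \<Sum>x\<in>S. \<Sum>y\<in>S. \<Sum>y'\<in>S'. (if \<phi> x = x' \<and> \<psi> y = y' then w x y else 0) * d' x' y')"
      unfolding v_def sum_distrib_right
      by (intro sum.cong refl) (subst sum.swap, intro sum.cong refl, rule sum.swap)
    also have "\<dots> = (\<Sum>x\<in>S. \<Sum>y\<in>S. \<Sum>x'\<in>S'. \<Sum>y'\<in>S'. (if \<phi> x = x' \<and> \<psi> y = y' then w x y else 0) * d' x' y')"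
      by (subst sum.swap, intro sum.cong refl, rule sum.swap)
    also have "\<dots> = (\<Sum>x\<in>S. \<Sum>y\<in>S. w x y * d' (\<phi> x) (\<psi> y))"
    proof (intro sum.cong refl)
      fix x y assume "x \<in> S" "y \<in> S"
      then have mem: "\<phi> x \<in> S'" "\<psi> y \<in> S'" using maps by auto
      have "(\<Sum>x'\<in>S'. \<Sum>y'\<in>S'. (if \<phi> x = x' \<and> \<psi> y = y' then w x y else 0) * d' x' y') =
        (\<Sum>x'\<in>S'. if \<phi> x = x' then \<Sum>y'\<in>S'. if \<psi> y = y' then w x y * d' x' y' else 0 else 0)"
        by (intro sum.cong refl) (auto intro!: sum.cong)
      also have "\<dots> = w x y * d' (\<phi> x) (\<psi> y)"
        using mem fin by simp
      finally show "(\<Sum>x'\<in>S'. \<Sum>y'\<in>S'. (if \<phi> x = x' \<and> \<psi> y = y' then w x y else 0) * d' x' y')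
        = w x y * d' (\<phi> x) (\<psi> y)" .
    qed
    also have "\<dots> \<le> (\<Sum>x\<in>S. \<Sum>y\<in>S. w x y * (d x y + k))"
      using w(1) d by (intro sum_mono mult_left_mono) auto
    also have "\<dots> = (\<Sum>x\<in>S. \<Sum>y\<in>S. w x y * d x y) + k * (\<Sum>x\<in>S. \<Sum>y\<in>S. w x y)"
      by (simp add: distrib_left sum.distrib sum_distrib_left mult.commute)
    also have "(\<Sum>x\<in>S. \<Sum>y\<in>S. w x y) = 1"
      using w(2) sum_unif[OF fin(1) AB(1,3)] by simp
    finally show "(\<Sum>x'\<in>S'. \<Sum>y'\<in>S'. v x' y' * d' x' y') \<le> K + k"
      using w(4) by simp
  qed
qed

section \<open>Two sets with a large common part, and mixtures over fibers\<close>

lemma card_mult_unif: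
  "finite A \<Longrightarrow> real (card A) * unif A x = indicator A x"
  by (cases "A = {}") (simp_all add: unif_def)

lemma sum_indicator_card:
  "finite S \<Longrightarrow> A \<subseteq> S \<Longrightarrow> (\<Sum>x\<in>S. indicator A x :: real) = real (card A)"
  by (simp add: indicator_def sum.If_cases Int_absorb1)

text \<open>The mass movement described above, separated from colorings. The indicator identities
  express the disjoint unions in a form that can be summed directly. Sending an excess to the whole
  of \<open>Y\<close>, or taking it from the whole of \<open>X\<close>, keeps both marginals
  proportional to uniform weights.\<close>

lemma transport_common_part:
  fixes X Y Z :: "'a set" and X' Y' :: "'j \<Rightarrow> 'a set" and \<epsilon> C :: real
  assumes fin: "finite S" "finite J" and sub: "X \<subseteq> S" "Y \<subseteq> S" and ne: "X \<noteq> {}" "Y \<noteq> {}"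
    and d0: "\<And>x. d x x = 0"
    and X: "\<And>x. indicator X x = indicator Z x + (\<Sum>j\<in>J. indicator (X' j) x :: real)"
    and Y: "\<And>x. indicator Y x = indicator Z x + (\<Sum>j\<in>J. indicator (Y' j) x :: real)"
    and small: "\<And>j. j \<in> J \<Longrightarrow> (1 + \<epsilon>) * real (card J) * real (card (X' j)) \<le> real (card Z)"
      "\<And>j. j \<in> J \<Longrightarrow> (1 + \<epsilon>) * real (card J) * real (card (Y' j)) \<le> real (card Z)"
    and X'Y': "\<And>j. j \<in> J \<Longrightarrow> X' j \<noteq> {} \<Longrightarrow> Y' j \<noteq> {} \<Longrightarrow> transport d S (unif (X' j)) (unif (Y' j)) C"
    and X'Y: "\<And>j. j \<in> J \<Longrightarrow> X' j \<noteq> {} \<Longrightarrow> transport d S (unif (X' j)) (unif Y) C"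
    and XY': "\<And>j. j \<in> J \<Longrightarrow> Y' j \<noteq> {} \<Longrightarrow> transport d S (unif X) (unif (Y' j)) C"
    and pos: "0 < \<epsilon>" "0 \<le> C"
  shows "transport d S (unif X) (unif Y) (C / (2 + \<epsilon>))"
proof -
  define h k where "h j = real (card (X' j))" and "k j = real (card (Y' j))" for j
  define z where "z = real (card Z)"
  \<comment> \<open>Index \<open>j\<close> moves mass \<open>min (h j) (k j)\<close> and then the
    excess of the larger size, altogether \<open>max (h j) (k j)\<close>. Hence \<open>s\<close> is
    the mass moved and \<open>M\<close> the total mass.\<close>
  define s where "s = (\<Sum>j\<in>J. max (h j) (k j))"
  define M where "M = z + s"
  have ind0: "0 \<le> (\<Sum>j\<in>J. indicator (A j) x :: real)" for A :: "'j \<Rightarrow> 'a set" and x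
    by (intro sum_nonneg) simp
  have part: "Z \<subseteq> W" "\<And>j. j \<in> J \<Longrightarrow> W' j \<subseteq> W"
    if "\<And>x. indicator W x = indicator Z x + (\<Sum>j\<in>J. indicator (W' j) x :: real)" for W W'
  proof -
    show "Z \<subseteq> W"
    proof
      fix x assume "x \<in> Z"
      with that[of x] ind0[of W' x] show "x \<in> W"
        by (cases "x \<in> W") auto
    qed
    show "W' j \<subseteq> W" if "j \<in> J" for j
    proof
      fix x assume "x \<in> W' j"
      then have "1 \<le> (\<Sum>j\<in>J. indicator (W' j) x :: real)"
        using member_le_sum[of j J "\<lambda>j. indicator (W' j) x :: real"] \<open>j \<in> J\<close> fin by simp
      moreover have "0 \<le> (indicator Z x :: real)" by simp
      ultimately have "0 < (indicator W x :: real)"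
        unfolding \<open>\<And>x. indicator W x = indicator Z x + (\<Sum>j\<in>J. indicator (W' j) x)\<close> by linarith
      then show "x \<in> W" by (cases "x \<in> W") auto
    qed
  qed
  have ZS: "Z \<subseteq> S" and X'S: "\<And>j. j \<in> J \<Longrightarrow> X' j \<subseteq> S" and Y'S: "\<And>j. j \<in> J \<Longrightarrow> Y' j \<subseteq> S"
    using part[OF X] part[OF Y] sub by blast+
  have finX': "finite (X' j)" and finY': "finite (Y' j)" if "j \<in> J" for j
    using X'S[OF that] Y'S[OF that] fin(1) finite_subset by auto
  have finXY: "finite X" "finite Y" using sub fin(1) finite_subset by auto
  have "real (card X) = (\<Sum>x\<in>S. indicator Z x + (\<Sum>j\<in>J. indicator (X' j) x))"
    unfolding X[symmetric] using sum_indicator_card[OF fin(1) sub(1)] by simp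
  also have "\<dots> = z + (\<Sum>j\<in>J. h j)"
    using fin(1) ZS X'S by (simp add: sum.distrib sum_indicator_card z_def h_def sum.swap[of _ J S])
  finally have cardX: "real (card X) = z + (\<Sum>j\<in>J. h j)" .
  have "real (card Y) = (\<Sum>x\<in>S. indicator Z x + (\<Sum>j\<in>J. indicator (Y' j) x))"
    unfolding Y[symmetric] using sum_indicator_card[OF fin(1) sub(2)] by simp
  also have "\<dots> = z + (\<Sum>j\<in>J. k j)"
    using fin(1) ZS Y'S by (simp add: sum.distrib sum_indicator_card z_def k_def sum.swap[of _ J S])
  finally have cardY: "real (card Y) = z + (\<Sum>j\<in>J. k j)" .
  have s0: "0 \<le> s" unfolding s_def h_def by (intro sum_nonneg) auto
  have "z + (\<Sum>j\<in>J. h j) \<le> M"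
    unfolding M_def s_def by (intro add_left_mono sum_mono) auto
  moreover have "0 < real (card X)" using ne(1) finXY by (simp add: card_gt_0_iff)
  ultimately have M0: "0 < M" using cardX by linarith

  \<comment> \<open>Left and right marginals of the combined plan, term by term: stay in place,
    piece to piece, excess of \<open>X' j\<close> to \<open>Y\<close>, excess of \<open>Y' j\<close>
    from \<open>X\<close>. For each \<open>j\<close> at most one excess is nonzero.\<close>
  define F G where
    "F x = indicator Z x + (\<Sum>j\<in>J. min (h j) (k j) * unif (X' j) x + max (h j - k j) 0 * unif (X' j) x
      + max (k j - h j) 0 * unif X x)" and
    "G x = indicator Z x + (\<Sum>j\<in>J. min (h j) (k j) * unif (Y' j) x + max (h j - k j) 0 * unif Y x
      + max (k j - h j) 0 * unif (Y' j) x)" for x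
  have tr: "transport d S F G (0 + (\<Sum>j\<in>J. min (h j) (k j) * C + max (h j - k j) 0 * C + max (k j - h j) 0 * C))"
    unfolding F_def G_def
  proof (intro transport_add transport_sum transport_scale transport_refl X'Y' X'Y XY' fin d0)
    fix j assume "j \<in> J"
    show "0 \<le> min (h j) (k j)" by (simp add: h_def k_def)
    show "X' j \<noteq> {}" "Y' j \<noteq> {}" if "0 < min (h j) (k j)"
      using that by (auto simp: h_def k_def)
    show "X' j \<noteq> {}" if "0 < max (h j - k j) 0"
      using that by (auto simp: h_def k_def)
    show "Y' j \<noteq> {}" if "0 < max (k j - h j) 0"
      using that by (auto simp: h_def k_def)
  qed auto
  \<comment> \<open>The first two terms for \<open>j\<close> add up to the indicator of
    \<open>X' j\<close> and, with \<open>Z\<close>, rebuild \<open>X\<close>; the remaining excesses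
    are multiples of \<open>unif X\<close>.\<close>
  have "F = (\<lambda>x. M * unif X x)"
  proof
    fix x
    have "F x = indicator Z x + (\<Sum>j\<in>J. h j * unif (X' j) x + (max (h j) (k j) - h j) * unif X x)"
      unfolding F_def by (rule arg_cong[where f = "\<lambda>t. indicator Z x + t"], rule sum.cong)
        (auto simp: min_def max_def algebra_simps)
    also have "\<dots> = indicator Z x + (\<Sum>j\<in>J. indicator (X' j) x) + (s - (\<Sum>j\<in>J. h j)) * unif X x"
      using finX' by (simp add: sum.distrib h_def card_mult_unif sum_distrib_right[symmetric] s_def sum_subtractf)
    also have "\<dots> = real (card X) * unif X x + (s - (\<Sum>j\<in>J. h j)) * unif X x"
      unfolding X[symmetric] using card_mult_unif[OF finXY(1)] by simp
    also have "\<dots> = M * unif X x"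
      unfolding cardX M_def by (simp add: algebra_simps)
    finally show "F x = M * unif X x" .
  qed
  moreover have "G = (\<lambda>x. M * unif Y x)"
  proof
    fix x
    have "G x = indicator Z x + (\<Sum>j\<in>J. k j * unif (Y' j) x + (max (h j) (k j) - k j) * unif Y x)"
      unfolding G_def by (rule arg_cong[where f = "\<lambda>t. indicator Z x + t"], rule sum.cong)
        (auto simp: min_def max_def algebra_simps)
    also have "\<dots> = indicator Z x + (\<Sum>j\<in>J. indicator (Y' j) x) + (s - (\<Sum>j\<in>J. k j)) * unif Y x"
      using finY' by (simp add: sum.distrib k_def card_mult_unif sum_distrib_right[symmetric] s_def sum_subtractf)
    also have "\<dots> = real (card Y) * unif Y x + (s - (\<Sum>j\<in>J. k j)) * unif Y x"
      unfolding Y[symmetric] using card_mult_unif[OF finXY(2)] by simp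
    also have "\<dots> = M * unif Y x"
      unfolding cardY M_def by (simp add: algebra_simps)
    finally show "G x = M * unif Y x" .
  qed
  moreover have "0 + (\<Sum>j\<in>J. min (h j) (k j) * C + max (h j - k j) 0 * C + max (k j - h j) 0 * C) = s * C"
    unfolding s_def sum_distrib_right add_0
    by (intro sum.cong refl) (auto simp: min_def max_def algebra_simps)
  ultimately have "transport d S (\<lambda>x. M * unif X x) (\<lambda>x. M * unif Y x) (s * C)"
    using tr by (simp only:)
  from transport_scale[of "1 / M", OF _ this] M0
  have tr1: "transport d S (unif X) (unif Y) (1 / M * (s * C))" by simp
  \<comment> \<open>Each \<open>max (h j) (k j)\<close> is at most
    \<open>z / ((1 + \<epsilon>) * card J)\<close>, and summing over \<open>J\<close> cancels
    \<open>card J\<close>. If \<open>J\<close> is empty nothing moves, so the later induction has no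
    separate base case.\<close>
  have sz: "(1 + \<epsilon>) * s \<le> z"
  proof (cases "J = {}")
    case True
    then show ?thesis by (simp add: s_def z_def)
  next
    case False
    then have J0: "0 < real (card J)" using fin by (simp add: card_gt_0_iff)
    have "real (card J) * ((1 + \<epsilon>) * s) = (\<Sum>j\<in>J. (1 + \<epsilon>) * real (card J) * max (h j) (k j))"
      by (simp add: s_def sum_distrib_left mult_ac)
    also have "\<dots> \<le> (\<Sum>j\<in>J. z)"
      using small by (intro sum_mono) (auto simp: max_def h_def k_def z_def)
    also have "\<dots> = real (card J) * z" by simp
    finally show ?thesis using J0 by simp
  qed
  have "1 / M * (s * C) \<le> C / (2 + \<epsilon>)"
  proof -
    \<comment> \<open>Since \<open>M = z + s\<close> and \<open>z\<close> is at least
      \<open>(1 + \<epsilon>) * s\<close>, the moved fraction is at most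
      \<open>1 / (2 + \<epsilon>)\<close>.\<close>
    have "s * (2 + \<epsilon>) \<le> M"
      using sz unfolding M_def by (simp add: algebra_simps)
    then have "s / M \<le> 1 / (2 + \<epsilon>)"
      using M0 pos(1) by (simp add: field_simps)
    from mult_right_mono[OF this pos(2)] show ?thesis by simp
  qed
  with tr1 show ?thesis by (rule transport_mono)
qed

text \<open>\<open>unif Y\<close> is the mixture of the uniform weights on the fibers of
  \<open>p\<close>, weighted by relative size; empty fibers have weight 0 and ask for no
  plan.\<close>

lemma transport_fibers:
  assumes fin: "finite S" "Y \<subseteq> S" "Y \<noteq> {}" "finite I" "\<And>y. y \<in> Y \<Longrightarrow> p y \<in> I"
    and tr: "\<And>c. c \<in> I \<Longrightarrow> {y \<in> Y. p y = c} \<noteq> {} \<Longrightarrow> transport d S f (unif {y \<in> Y. p y = c}) K"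
  shows "transport d S f (unif Y) K"
proof -
  have finY: "finite Y" using fin finite_subset by blast
  have Y0: "0 < real (card Y)" using finY fin(3) by (simp add: card_gt_0_iff)
  have decomp: "indicator Y y = (\<Sum>c\<in>I. indicator {y \<in> Y. p y = c} y :: real)" for y
  proof (cases "y \<in> Y")
    case True
    then have "(\<Sum>c\<in>I. indicator {y \<in> Y. p y = c} y :: real) = (\<Sum>c\<in>I. if p y = c then 1 else 0)"
      by (intro sum.cong) auto
    with True fin(4,5) show ?thesis by simp
  qed simp
  define a where "a c = real (card {y \<in> Y. p y = c}) / real (card Y)" for c
  have "(\<Sum>y\<in>S. indicator Y y :: real) = (\<Sum>c\<in>I. \<Sum>y\<in>S. indicator {y \<in> Y. p y = c} y)"
    unfolding decomp by (rule sum.swap)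
  also have "\<dots> = (\<Sum>c\<in>I. real (card {y \<in> Y. p y = c}))"
    using fin by (intro sum.cong refl sum_indicator_card) auto
  finally have "real (card Y) = (\<Sum>c\<in>I. real (card {y \<in> Y. p y = c}))"
    using sum_indicator_card[OF fin(1,2)] by simp
  then have a1: "(\<Sum>c\<in>I. a c) = 1"
    using Y0 by (simp add: a_def sum_divide_distrib[symmetric])
  have "transport d S f (\<lambda>y. \<Sum>c\<in>I. a c * unif {y \<in> Y. p y = c} y) K"
  proof (rule transport_mixture_right[OF fin(4) _ a1])
    fix c assume "c \<in> I" "0 < a c"
    then show "transport d S f (unif {y \<in> Y. p y = c}) K"
      by (intro tr) (auto simp: a_def simp del: Collect_empty_eq)
  qed (simp add: a_def)
  moreover have "(\<Sum>c\<in>I. a c * unif {y \<in> Y. p y = c} y) = unif Y y" for y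
  proof -
    have "a c * unif {y \<in> Y. p y = c} y = indicator {y \<in> Y. p y = c} y / real (card Y)" for c
      using card_mult_unif[of "{y \<in> Y. p y = c}" y] finY by (simp add: a_def)
    then show ?thesis
      by (simp add: sum_divide_distrib[symmetric] decomp[symmetric] unif_def)
  qed
  ultimately show ?thesis by simp
qed

section \<open>From transport plans to the Wasserstein distance\<close>

lemma transport_imp_wasserstein1_le:
  assumes fin: "finite S" and AB: "A \<subseteq> S" "B \<subseteq> S" "A \<noteq> {}" "B \<noteq> {}"
    and d: "\<And>x y. 0 \<le> d x y" and tr: "transport d S (unif A) (unif B) K"
  shows "wasserstein1 d (pmf_of_set A) (pmf_of_set B) \<le> K"
proof -
  obtain w where w: "\<And>x y. 0 \<le> w x y" "\<And>x. x \<in> S \<Longrightarrow> (\<Sum>y\<in>S. w x y) = unif A x"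
    "\<And>y. y \<in> S \<Longrightarrow> (\<Sum>x\<in>S. w x y) = unif B y" "(\<Sum>x\<in>S. \<Sum>y\<in>S. w x y * d x y) \<le> K"
    using tr by (rule transportE) blast
  have finAB: "finite A" "finite B" using AB fin finite_subset by auto
  \<comment> \<open>Outside \<open>S\<close> only the sign of \<open>w\<close> is known, so
    \<open>w\<close> is cut off to 0 there; on \<open>S \<times> S\<close> its total mass is
    1.\<close>
  define p where "p z = (if z \<in> S \<times> S then w (fst z) (snd z) else 0)" for z
  have p0: "0 \<le> p z" for z using w(1) by (simp add: p_def)
  have finSS: "finite (S \<times> S)" using fin by simp
  have sum1: "(\<Sum>z\<in>S \<times> S. p z) = 1"
  proof -
    have "(\<Sum>z\<in>S \<times> S. p z) = (\<Sum>x\<in>S. \<Sum>y\<in>S. w x y)"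
      unfolding sum.cartesian_product by (intro sum.cong) (auto simp: p_def)
    also have "\<dots> = 1" using w(2) sum_unif[OF fin AB(1,3)] by simp
    finally show ?thesis .
  qed
  have "(\<integral>\<^sup>+ z. ennreal (p z) \<partial>count_space UNIV) = (\<integral>\<^sup>+ z. ennreal (p z) \<partial>count_space (S \<times> S))"
    by (rule nn_integral_count_space_eq) (auto simp: p_def)
  also have "\<dots> = ennreal (\<Sum>z\<in>S \<times> S. p z)"
    using finSS p0 by (simp add: nn_integral_count_space_finite sum_ennreal)
  finally have int1: "(\<integral>\<^sup>+ z. ennreal (p z) \<partial>count_space UNIV) = 1"
    using sum1 by simp
  define \<omega> where "\<omega> = embed_pmf p"
  have pmf: "pmf \<omega> z = p z" for z
    unfolding \<omega>_def using p0 int1 by (rule pmf_embed_pmf)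
  have set: "set_pmf \<omega> \<subseteq> S \<times> S"
    by (auto simp: set_pmf_eq pmf p_def split: if_splits)
  have meas: "measure_pmf.prob \<omega> E = (\<Sum>z\<in>S \<times> S \<inter> E. p z)" for E
  proof -
    have "measure_pmf.prob \<omega> E = measure_pmf.prob \<omega> (S \<times> S \<inter> E)"
      using set by (intro measure_eq_AE) (auto simp: AE_measure_pmf_iff)
    also have "\<dots> = (\<Sum>z\<in>S \<times> S \<inter> E. p z)"
      using finSS by (subst measure_measure_pmf_finite) (auto simp: pmf)
    finally show ?thesis .
  qed
  have unif: "pmf (pmf_of_set C) x = unif C x" if "finite C" "C \<noteq> {}" for C :: "'a set" and x
    using that by (simp add: unif_def)
  have "pmf (map_pmf fst \<omega>) x = pmf (pmf_of_set A) x" for x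
  proof (cases "x \<in> S")
    case True
    have "pmf (map_pmf fst \<omega>) x = (\<Sum>z\<in>S \<times> S \<inter> fst -` {x}. p z)"
      by (simp add: pmf_map meas)
    also have "\<dots> = (\<Sum>z\<in>{x} \<times> S. p z)"
      using True by (intro sum.cong) auto
    also have "\<dots> = (\<Sum>y\<in>S. w x y)"
      unfolding sum.cartesian_product' using True by (simp add: p_def)
    finally show ?thesis using w(2)[OF True] unif finAB AB by simp
  next
    case False
    then have "pmf (map_pmf fst \<omega>) x = 0" using set by (force simp: pmf_eq_0_set_pmf)
    moreover have "x \<notin> A" using False AB by blast
    ultimately show ?thesis using finAB AB by simp
  qed
  moreover have "pmf (map_pmf snd \<omega>) y = pmf (pmf_of_set B) y" for y
  proof (cases "y \<in> S")
    case True
    have "pmf (map_pmf snd \<omega>) y = (\<Sum>z\<in>S \<times> S \<inter> snd -` {y}. p z)"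
      by (simp add: pmf_map meas)
    also have "\<dots> = (\<Sum>z\<in>S \<times> {y}. p z)"
      using True by (intro sum.cong) auto
    also have "\<dots> = (\<Sum>x\<in>S. w x y)"
      unfolding sum.cartesian_product' using True by (simp add: p_def)
    finally show ?thesis using w(3)[OF True] unif finAB AB by simp
  next
    case False
    then have "pmf (map_pmf snd \<omega>) y = 0" using set by (force simp: pmf_eq_0_set_pmf)
    moreover have "y \<notin> B" using False AB by blast
    ultimately show ?thesis using finAB AB by simp
  qed
  ultimately have "\<omega> \<in> couplings (pmf_of_set A) (pmf_of_set B)"
    unfolding couplings_def by (auto intro: pmf_eqI)
  \<comment> \<open>A real infimum is known to lie below its members only if they are bounded below;
    nonnegativity of \<open>d\<close> supplies the bound 0.\<close>
  moreover have "bdd_below ((\<lambda>\<omega>. measure_pmf.expectation \<omega> (\<lambda>(x, y). d x y)) `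
      couplings (pmf_of_set A) (pmf_of_set B))"
    using d by (intro bdd_belowI2[where m = 0] integral_nonneg_AE) auto
  ultimately have "wasserstein1 d (pmf_of_set A) (pmf_of_set B) \<le>
      measure_pmf.expectation \<omega> (\<lambda>(x, y). d x y)"
    unfolding wasserstein1_def by (rule cINF_lower[rotated])
  also have "\<dots> = (\<Sum>z\<in>S \<times> S. p z * (case z of (x, y) \<Rightarrow> d x y))"
    using set finSS by (subst integral_measure_pmf[of "S \<times> S"]) (auto simp: pmf)
  also have "\<dots> = (\<Sum>x\<in>S. \<Sum>y\<in>S. w x y * d x y)"
    unfolding sum.cartesian_product by (intro sum.cong) (auto simp: p_def)
  finally show ?thesis using w(4) by linarith
qed

section \<open>Edge colorings\<close>

lemma hamming_self: "hamming H x x = 0"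
  by (simp add: hamming_def)

lemma hamming_commute: "hamming H x y = hamming H y x"
  by (simp add: hamming_def eq_commute)

lemma hamming_triangle:
  assumes "finite H"
  shows "hamming H x z \<le> hamming H x y + hamming H y z"
proof -
  have "card {e \<in> H. x e \<noteq> z e} \<le> card ({e \<in> H. x e \<noteq> y e} \<union> {e \<in> H. y e \<noteq> z e})"
    using assms by (intro card_mono) auto
  also have "\<dots> \<le> card {e \<in> H. x e \<noteq> y e} + card {e \<in> H. y e \<noteq> z e}"
    by (rule card_Un_le)
  finally show ?thesis by (simp add: hamming_def)
qed

lemma hamming_fun_upd_le:
  assumes "finite H"
  shows "hamming H (x(e := c)) (y(e := c')) \<le> hamming (H - {e}) x y + 1"
proof -
  have "card {f \<in> H. (x(e := c)) f \<noteq> (y(e := c')) f} \<le> card (insert e {f \<in> H - {e}. x f \<noteq> y f})"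
    using assms by (intro card_mono) auto
  also have "\<dots> \<le> Suc (card {f \<in> H - {e}. x f \<noteq> y f})"
    by (rule card_insert_le_m1) auto
  finally show ?thesis by (simp add: hamming_def)
qed

section \<open>Deleting a color at a vertex, and deleting an edge\<close>

text \<open>Models what a colored edge leaves behind at one end: once an edge at \<open>v\<close> is
  colored \<open>c\<close> and deleted, the other edges at \<open>v\<close> lose
  \<open>c\<close>.\<close>

definition remove_color :: "('v set \<Rightarrow> nat set) \<Rightarrow> 'v \<Rightarrow> nat \<Rightarrow> 'v set \<Rightarrow> nat set" where
  "remove_color L v c = (\<lambda>e. if v \<in> e then L e - {c} else L e)"

text \<open>Of two deletions either can be taken as the outer one, which is the one that the
  one-vertex estimate varies.\<close>

lemma remove_color_commute:
  "remove_color (remove_color L v c) v' c' = remove_color (remove_color L v' c') v c"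
  by (auto simp: remove_color_def fun_eq_iff)

lemma remove_color_subset: "L e \<subseteq> Q \<Longrightarrow> remove_color L v c e \<subseteq> Q"
  by (auto simp: remove_color_def)

lemma proper_edge_colorings_subset: "proper_edge_colorings H q L \<subseteq> H \<rightarrow>\<^sub>E {1..q}"
  by (auto simp: proper_edge_colorings_def)

lemma proper_edge_colorings_mem: "\<sigma> \<in> proper_edge_colorings H q L \<Longrightarrow> e \<in> H \<Longrightarrow> \<sigma> e \<in> L e"
  by (simp add: proper_edge_colorings_def)

lemma proper_edge_colorings_adjacent:
  "\<sigma> \<in> proper_edge_colorings H q L \<Longrightarrow> e \<in> H \<Longrightarrow> f \<in> H \<Longrightarrow> e \<noteq> f \<Longrightarrow> e \<inter> f \<noteq> {} \<Longrightarrow> \<sigma> e \<noteq> \<sigma> f"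
  by (simp add: proper_edge_colorings_def)

lemma finite_colorings: "finite H \<Longrightarrow> finite (H \<rightarrow>\<^sub>E {1..q::nat})"
  by (intro finite_PiE) auto

lemma finite_proper_edge_colorings: "finite H \<Longrightarrow> finite (proper_edge_colorings H q L)"
  by (rule finite_subset[OF proper_edge_colorings_subset finite_colorings])

text \<open>Greedy coloring: when \<open>e\<close> is colored, its already colored neighbors block
  at most \<open>edge_degree H e\<close> colors, fewer than its list holds.\<close>

lemma proper_edge_colorings_nonempty:
  assumes fin: "finite H" and L: "\<And>e. e \<in> H \<Longrightarrow> L e \<subseteq> {1..q}"
    and deg: "\<And>e. e \<in> H \<Longrightarrow> edge_degree H e < card (L e)"
  shows "proper_edge_colorings H q L \<noteq> {}"
proof -
  have "proper_edge_colorings F q L \<noteq> {}" if "finite F" "F \<subseteq> H" for F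
    using that
  proof (induction F rule: finite_induct)
    case empty
    have "(\<lambda>_. undefined) \<in> proper_edge_colorings {} q L"
      by (simp add: proper_edge_colorings_def)
    then show ?case by blast
  next
    case (insert e F)
    then obtain \<sigma> where \<sigma>: "\<sigma> \<in> proper_edge_colorings F q L" by blast
    let ?N = "{f \<in> F. f \<noteq> e \<and> f \<inter> e \<noteq> {}}"
    have "card (\<sigma> ` ?N) \<le> card ?N"
      using insert.hyps by (intro card_image_le) auto
    also have "\<dots> \<le> edge_degree H e"
      unfolding edge_degree_def using insert.prems fin by (intro card_mono) auto
    also have "\<dots> < card (L e)" using deg insert.prems by simp
    finally have "\<not> L e \<subseteq> \<sigma> ` ?N"
      using insert.hyps card_mono[of "\<sigma> ` ?N" "L e"] by auto
    then obtain c where c: "c \<in> L e" "c \<notin> \<sigma> ` ?N" by blast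
    have "c \<in> {1..q}" using c L insert.prems by blast
    then have "\<sigma>(e := c) \<in> proper_edge_colorings (insert e F) q L"
      using \<sigma> c insert.hyps
      by (auto simp: proper_edge_colorings_def PiE_iff extensional_def Int_commute)
    then show ?case by blast
  qed
  then show ?thesis using fin by blast
qed

text \<open>An edge other than \<open>e\<close> contains at most one of \<open>u\<close> and
  \<open>w\<close>. If it contains one, it loses at most one color and exactly one neighbor, namely
  \<open>e\<close>; otherwise its list is unchanged. The colors \<open>c\<close> and
  \<open>c'\<close> may differ, as they do in intermediate instances.\<close>

lemma extra_delete_edge:
  assumes fin: "finite H" and card2: "\<And>f. f \<in> H \<Longrightarrow> card f = 2"
    and e: "e \<in> H" "e = {u, w}" "u \<noteq> w" and ex: "extra \<beta> H M"
  shows "extra \<beta> (H - {e}) (remove_color (remove_color M u c) w c')"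
  unfolding extra_def
proof
  fix f assume f: "f \<in> H - {e}"
  then have f2: "card f = 2" and Mf: "real (edge_degree H f) + \<beta> \<le> real (card (M f))"
    using card2 ex by (auto simp: extra_def)
  have "\<not> {u, w} \<subseteq> f"
  proof
    assume "{u, w} \<subseteq> f"
    then have "{u, w} = f"
      using f2 e(3) by (intro card_subset_eq) (auto intro: card_ge_0_finite)
    with f e(2) show False by simp
  qed
  then consider (disj) "u \<notin> f" "w \<notin> f" | (u) "u \<in> f" "w \<notin> f" | (w) "u \<notin> f" "w \<in> f" by blast
  then show "real (edge_degree (H - {e}) f) + \<beta> \<le> real (card (remove_color (remove_color M u c) w c' f))"
  proof cases
    case disj
    have "edge_degree (H - {e}) f \<le> edge_degree H f"
      unfolding edge_degree_def using fin by (intro card_mono) auto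
    with Mf disj show ?thesis by (simp add: remove_color_def)
  next
    case u
    then have "{g \<in> H. g \<noteq> f \<and> g \<inter> f \<noteq> {}} = insert e {g \<in> H - {e}. g \<noteq> f \<and> g \<inter> f \<noteq> {}}"
      using e f by auto
    then have "edge_degree H f = Suc (edge_degree (H - {e}) f)"
      unfolding edge_degree_def using fin by simp
    moreover have "card (M f) - 1 \<le> card (M f - {c})" by (simp add: card_Diff_singleton_if)
    ultimately show ?thesis using Mf u by (simp add: remove_color_def)
  next
    case w
    then have "{g \<in> H. g \<noteq> f \<and> g \<inter> f \<noteq> {}} = insert e {g \<in> H - {e}. g \<noteq> f \<and> g \<inter> f \<noteq> {}}"
      using e f by auto
    then have "edge_degree H f = Suc (edge_degree (H - {e}) f)"
      unfolding edge_degree_def using fin by simp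
    moreover have "card (M f) - 1 \<le> card (M f - {c'})" by (simp add: card_Diff_singleton_if)
    ultimately show ?thesis using Mf w by (simp add: remove_color_def)
  qed
qed

text \<open>The color of \<open>e\<close> can be forgotten and restored. The neighbors of
  \<open>e\<close> are the other edges at \<open>u\<close> or \<open>w\<close>, so properness
  against \<open>e\<close> amounts to deleting \<open>c\<close> from the lists there.\<close>

lemma pinned_colorings_eq:
  assumes e: "e \<in> H" "e = {u, w}" and c: "c \<in> M e" "c \<in> {1..q}"
  shows "{\<sigma> \<in> proper_edge_colorings H q M. \<sigma> e = c} =
    (\<lambda>\<tau>. \<tau>(e := c)) ` proper_edge_colorings (H - {e}) q (remove_color (remove_color M u c) w c)"
    (is "?A = ?f ` ?B")
proof
  show "?A \<subseteq> ?f ` ?B"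
  proof
    fix \<sigma> assume \<sigma>: "\<sigma> \<in> ?A"
    then have adj: "\<sigma> f \<noteq> c" if "f \<in> H" "f \<noteq> e" "f \<inter> e \<noteq> {}" for f
      using that e(1) proper_edge_colorings_adjacent[of \<sigma> H q M f e] by auto
    have "\<sigma> f \<noteq> c" if "f \<in> H" "f \<noteq> e" "u \<in> f \<or> w \<in> f" for f
      using that e(2) by (intro adj) auto
    \<comment> \<open>\<open>undefined\<close> is the value that extensional functions on
      \<open>H - {e}\<close> take at \<open>e\<close>.\<close>
    with \<sigma> have "\<sigma>(e := undefined) \<in> ?B"
      by (auto simp: proper_edge_colorings_def PiE_iff extensional_def remove_color_def)
    moreover have "\<sigma> = ?f (\<sigma>(e := undefined))" using \<sigma> by auto
    ultimately show "\<sigma> \<in> ?f ` ?B" by (intro image_eqI[where x = "\<sigma>(e := undefined)" and f = ?f])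
  qed
next
  show "?f ` ?B \<subseteq> ?A"
  proof
    fix \<sigma> assume "\<sigma> \<in> ?f ` ?B"
    then obtain \<tau> where \<tau>: "\<tau> \<in> ?B" "\<sigma> = \<tau>(e := c)" by blast
    have ne: "\<tau> f \<noteq> c" if "f \<in> H" "f \<noteq> e" "f \<inter> e \<noteq> {}" for f
    proof -
      have "u \<in> f \<or> w \<in> f" using that e(2) by auto
      moreover have "\<tau> f \<in> remove_color (remove_color M u c) w c f"
        using proper_edge_colorings_mem[OF \<tau>(1), of f] that by simp
      ultimately show ?thesis by (auto simp: remove_color_def split: if_splits)
    qed
    have mem: "\<tau> f \<in> M f" if "f \<in> H" "f \<noteq> e" for f
    proof -
      have "\<tau> f \<in> remove_color (remove_color M u c) w c f"
        using proper_edge_colorings_mem[OF \<tau>(1), of f] that by simp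
      then show ?thesis by (auto simp: remove_color_def split: if_splits)
    qed
    have proper: "\<tau> f \<noteq> \<tau> g" if "f \<in> H" "g \<in> H" "f \<noteq> e" "g \<noteq> e" "f \<noteq> g" "f \<inter> g \<noteq> {}" for f g
      using proper_edge_colorings_adjacent[OF \<tau>(1), of f g] that by simp
    have "\<tau> \<in> (H - {e}) \<rightarrow>\<^sub>E {1..q}" using \<tau>(1) by (simp add: proper_edge_colorings_def)
    then have "\<sigma> \<in> H \<rightarrow>\<^sub>E {1..q}"
      using c(2) e(1) unfolding \<tau>(2) by (auto simp: PiE_iff extensional_def)
    moreover have "\<sigma> f \<in> M f" if "f \<in> H" for f
      using mem that c(1) unfolding \<tau>(2) by auto
    moreover have "\<sigma> f \<noteq> \<sigma> g" if "f \<in> H" "g \<in> H" "f \<noteq> g" "f \<inter> g \<noteq> {}" for f g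
      using proper[of f g] ne[of f] ne[of g] that unfolding \<tau>(2) by (auto simp: Int_commute)
    ultimately show "\<sigma> \<in> ?A" unfolding proper_edge_colorings_def \<tau>(2) by auto
  qed
qed

section \<open>Counting colorings by recoloring one edge\<close>

text \<open>Recolor \<open>e\<close> with a color of its list other than \<open>b\<close> and the
  colors of its neighbors; then \<open>b\<close> is gone from \<open>u\<close>. At least
  \<open>\<beta> - 1\<close> colors qualify: the list exceeds the degree by at least
  \<open>\<beta>\<close>, and \<open>b\<close> costs one more.\<close>

lemma card_pinned_colorings_le:
  assumes fin: "finite H" and M: "\<And>f. f \<in> H \<Longrightarrow> M f \<subseteq> {1..q}"
    and e: "e \<in> H" "u \<in> e" and ex: "extra \<beta> H M"
  shows "(\<beta> - 1) * real (card {\<sigma> \<in> proper_edge_colorings H q M. \<sigma> e = b}) \<le>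
    real (card (proper_edge_colorings H q (remove_color M u b)))"
proof -
  let ?A = "{\<sigma> \<in> proper_edge_colorings H q M. \<sigma> e = b}"
  let ?Z = "proper_edge_colorings H q (remove_color M u b)"
  let ?N = "{f \<in> H. f \<noteq> e \<and> f \<inter> e \<noteq> {}}"
  define av where "av \<sigma> = M e - {b} - \<sigma> ` ?N" for \<sigma>
  have finA: "finite ?A" using finite_proper_edge_colorings[OF fin] by simp
  have finM: "finite (M e)" using M[OF e(1)] finite_subset by blast
  have av: "\<beta> - 1 \<le> real (card (av \<sigma>))" for \<sigma>
  proof -
    have "card (\<sigma> ` ?N) \<le> edge_degree H e"
      unfolding edge_degree_def using fin by (intro card_image_le) auto
    moreover have "card (M e) - 1 \<le> card (M e - {b})" by (simp add: card_Diff_singleton_if)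
    moreover have "card (M e - {b}) - card (\<sigma> ` ?N) \<le> card (av \<sigma>)"
      unfolding av_def using fin by (intro diff_card_le_card_Diff) auto
    ultimately have "card (M e) \<le> card (av \<sigma>) + edge_degree H e + 1" by linarith
    moreover have "real (edge_degree H e) + \<beta> \<le> real (card (M e))"
      using ex e(1) by (auto simp: extra_def)
    ultimately show ?thesis by linarith
  qed
  have "(\<beta> - 1) * real (card ?A) = (\<Sum>\<sigma>\<in>?A. \<beta> - 1)" by simp
  also have "\<dots> \<le> (\<Sum>\<sigma>\<in>?A. real (card (av \<sigma>)))"
    by (intro sum_mono av)
  also have "\<dots> = real (card (Sigma ?A av))"
    using finA finM by (subst card_SigmaI) (auto simp: av_def)
  also have "card (Sigma ?A av) \<le> card ?Z"
  proof (rule card_inj_on_le[where f = "\<lambda>(\<sigma>, c). \<sigma>(e := c)"])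
    \<comment> \<open>Every coloring in \<open>?A\<close> has color \<open>b\<close> at
      \<open>e\<close>, so the recolored function determines the original.\<close>
    show "inj_on (\<lambda>(\<sigma>, c). \<sigma>(e := c)) (Sigma ?A av)"
    proof (rule inj_onI, clarify)
      fix \<sigma> c \<tau> c' assume eq: "\<sigma>(e := c) = \<tau>(e := c')" "\<tau> e = \<sigma> e"
      have "\<sigma> x = \<tau> x" for x
        using fun_cong[OF eq(1), of x] eq(2) by (cases "x = e") auto
      moreover have "c = c'" using fun_cong[OF eq(1), of e] by simp
      ultimately show "\<sigma> = \<tau> \<and> c = c'" by blast
    qed
    show "(\<lambda>(\<sigma>, c). \<sigma>(e := c)) ` Sigma ?A av \<subseteq> ?Z"
    proof clarify
      fix \<sigma> c assume \<sigma>: "\<sigma> \<in> proper_edge_colorings H q M" "b = \<sigma> e" and "c \<in> av \<sigma>"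
      then have c: "c \<in> M e" "c \<noteq> \<sigma> e" "\<And>f. f \<in> H \<Longrightarrow> f \<noteq> e \<Longrightarrow> f \<inter> e \<noteq> {} \<Longrightarrow> c \<noteq> \<sigma> f"
        by (auto simp: av_def)
      have proper: "\<sigma> f \<noteq> \<sigma> g" if "f \<in> H" "g \<in> H" "f \<noteq> g" "f \<inter> g \<noteq> {}" for f g
        using proper_edge_colorings_adjacent[OF \<sigma>(1)] that by simp
      have "\<sigma>(e := c) \<in> H \<rightarrow>\<^sub>E {1..q}"
        using \<sigma>(1) c(1) M[OF e(1)] e(1)
        by (auto simp: proper_edge_colorings_def PiE_iff extensional_def)
      moreover have "(\<sigma>(e := c)) f \<in> remove_color M u (\<sigma> e) f" if "f \<in> H" for f
      proof (cases "f = e")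
        case False
        have "\<sigma> f \<noteq> \<sigma> e" if "u \<in> f"
          using proper[of f e] that False e \<open>f \<in> H\<close> by auto
        moreover have "\<sigma> f \<in> M f" using \<sigma>(1) that by (auto simp: proper_edge_colorings_def)
        ultimately show ?thesis using False by (auto simp: remove_color_def)
      qed (use c in \<open>auto simp: remove_color_def\<close>)
      moreover have "(\<sigma>(e := c)) f \<noteq> (\<sigma>(e := c)) g" if "f \<in> H" "g \<in> H" "f \<noteq> g" "f \<inter> g \<noteq> {}" for f g
        using proper[OF that] c(3)[of f] c(3)[of g] that by (auto simp: Int_commute)
      ultimately show "\<sigma>(e := c) \<in> proper_edge_colorings H q (remove_color M u (\<sigma> e))"
        by (simp add: proper_edge_colorings_def)
    qed
    show "finite ?Z" by (rule finite_proper_edge_colorings[OF fin])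
  qed
  finally show ?thesis by simp
qed

text \<open>Edges at \<open>u\<close> are pairwise adjacent, so for a proper coloring the sum is 0
  or 1, and it is 0 exactly if the coloring survives the deletion of \<open>b\<close> at
  \<open>u\<close>.\<close>

lemma indicator_proper_edge_colorings_split:
  assumes "finite H"
  shows "indicator (proper_edge_colorings H q M) \<sigma> =
    indicator (proper_edge_colorings H q (remove_color M u b)) \<sigma> +
    (\<Sum>e\<in>{e \<in> H. u \<in> e}. indicator {\<sigma> \<in> proper_edge_colorings H q M. \<sigma> e = b} \<sigma> :: real)"
proof (cases "\<sigma> \<in> proper_edge_colorings H q M")
  case in_M: True
  let ?J = "{e \<in> H. u \<in> e}"
  show ?thesis
  proof (cases "\<exists>e\<in>?J. \<sigma> e = b")
    case True
    then obtain e where e: "e \<in> H" "u \<in> e" "\<sigma> e = b" by blast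
    have uniq: "f = e" if "f \<in> H" "u \<in> f" "\<sigma> f = b" for f
    proof (rule ccontr)
      assume "f \<noteq> e"
      moreover have "f \<inter> e \<noteq> {}" using that e by blast
      ultimately show False using proper_edge_colorings_adjacent[OF in_M, of f e] that e by simp
    qed
    have "(\<Sum>f\<in>?J. indicator {\<sigma> \<in> proper_edge_colorings H q M. \<sigma> f = b} \<sigma> :: real) =
        (\<Sum>f\<in>?J. if f = e then 1 else 0)"
    proof (intro sum.cong refl)
      fix f assume "f \<in> ?J"
      then have "\<sigma> f = b \<longleftrightarrow> f = e" using e(3) uniq[of f] by fast
      with in_M show "indicator {\<sigma> \<in> proper_edge_colorings H q M. \<sigma> f = b} \<sigma> = (if f = e then 1 else 0 :: real)"
        using e(3) by simp
    qed
    also have "\<dots> = 1" using e assms by simp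
    finally have "(\<Sum>f\<in>?J. indicator {\<sigma> \<in> proper_edge_colorings H q M. \<sigma> f = b} \<sigma> :: real) = 1" .
    moreover have "\<sigma> \<notin> proper_edge_colorings H q (remove_color M u b)"
      using proper_edge_colorings_mem[of \<sigma> H q "remove_color M u b" e] e by (auto simp: remove_color_def)
    ultimately show ?thesis using in_M by simp
  next
    case False
    have "(\<Sum>f\<in>?J. indicator {\<sigma> \<in> proper_edge_colorings H q M. \<sigma> f = b} \<sigma> :: real) = 0"
      using False by (intro sum.neutral) auto
    moreover have "\<sigma> \<in> proper_edge_colorings H q (remove_color M u b)"
      using False in_M by (auto simp: proper_edge_colorings_def remove_color_def)
    ultimately show ?thesis using in_M by simp
  qed
next
  case False
  then have "\<sigma> \<notin> proper_edge_colorings H q (remove_color M u b)"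
    by (auto simp: proper_edge_colorings_def remove_color_def split: if_splits)
  with False show ?thesis by simp
qed

section \<open>The one-vertex estimate and pinned edges\<close>

text \<open>Two hops: the color deleted at \<open>u\<close> changes from \<open>a\<close> to
  \<open>a'\<close>, then the one at \<open>w\<close> from \<open>b\<close> to \<open>b'\<close>.
  Each costs \<open>D\<close>, and putting \<open>e\<close> back adds 1. The one-vertex estimate
  enters as assumption \<open>IH\<close>, so that both its own induction and the final theorem can
  use the lemma.\<close>

lemma transport_pinned:
  assumes fin: "finite H" and c: "e \<in> H" "c \<in> {1..q}" "c' \<in> {1..q}"
    and K: "\<And>f. f \<in> H - {e} \<Longrightarrow> K f \<subseteq> {1..q}"
    and ne: "proper_edge_colorings (H - {e}) q (remove_color (remove_color K u a) w b) \<noteq> {}"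
    and ex: "extra \<beta> (H - {e}) (remove_color (remove_color K u a) w b)"
      "extra \<beta> (H - {e}) (remove_color (remove_color K u a') w b)"
      "extra \<beta> (H - {e}) (remove_color (remove_color K u a') w b')"
    and IH: "\<And>K v a a'. (\<And>f. f \<in> H - {e} \<Longrightarrow> K f \<subseteq> {1..q}) \<Longrightarrow>
      extra \<beta> (H - {e}) (remove_color K v a) \<Longrightarrow> extra \<beta> (H - {e}) (remove_color K v a') \<Longrightarrow>
      transport (hamming (H - {e})) ((H - {e}) \<rightarrow>\<^sub>E {1..q})
        (unif (proper_edge_colorings (H - {e}) q (remove_color K v a)))
        (unif (proper_edge_colorings (H - {e}) q (remove_color K v a'))) D"
  shows "transport (hamming H) (H \<rightarrow>\<^sub>E {1..q})
    (unif ((\<lambda>\<tau>. \<tau>(e := c)) ` proper_edge_colorings (H - {e}) q (remove_color (remove_color K u a) w b)))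
    (unif ((\<lambda>\<tau>. \<tau>(e := c')) ` proper_edge_colorings (H - {e}) q (remove_color (remove_color K u a') w b')))
    (D + D + 1)"
proof (rule transport_push[where d = "hamming (H - {e})" and S = "(H - {e}) \<rightarrow>\<^sub>E {1..q}"])
  have fin': "finite (H - {e})" using fin by simp
  show "finite ((H - {e}) \<rightarrow>\<^sub>E {1..q})" by (rule finite_colorings[OF fin'])
  show "finite (H \<rightarrow>\<^sub>E {1..q})" by (rule finite_colorings[OF fin])
  show "(\<lambda>\<tau>. \<tau>(e := c)) ` ((H - {e}) \<rightarrow>\<^sub>E {1..q}) \<subseteq> H \<rightarrow>\<^sub>E {1..q}"
    "(\<lambda>\<tau>. \<tau>(e := c')) ` ((H - {e}) \<rightarrow>\<^sub>E {1..q}) \<subseteq> H \<rightarrow>\<^sub>E {1..q}"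
    using c by (auto simp: PiE_iff extensional_def)
  have inj: "inj_on (\<lambda>\<tau>. \<tau>(e := x)) ((H - {e}) \<rightarrow>\<^sub>E {1..q})" for x :: nat
  proof (rule inj_onI)
    fix \<sigma> \<tau> assume "\<sigma> \<in> (H - {e}) \<rightarrow>\<^sub>E {1..q}" "\<tau> \<in> (H - {e}) \<rightarrow>\<^sub>E {1..q}"
      and eq: "\<sigma>(e := x) = \<tau>(e := x)"
    then have "\<sigma> e = \<tau> e" by (simp add: PiE_iff extensional_def)
    then show "\<sigma> = \<tau>" using eq by (metis fun_upd_triv fun_upd_upd)
  qed
  show "inj_on (\<lambda>\<tau>. \<tau>(e := c)) ((H - {e}) \<rightarrow>\<^sub>E {1..q})" by (rule inj)
  show "inj_on (\<lambda>\<tau>. \<tau>(e := c')) ((H - {e}) \<rightarrow>\<^sub>E {1..q})" by (rule inj)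
  have "transport (hamming (H - {e})) ((H - {e}) \<rightarrow>\<^sub>E {1..q})
    (unif (proper_edge_colorings (H - {e}) q (remove_color (remove_color K u a) w b)))
    (unif (proper_edge_colorings (H - {e}) q (remove_color (remove_color K u a') w b))) D"
    using ex(1,2) K unfolding remove_color_commute[of K u _ w b]
    by (intro IH remove_color_subset)
  moreover have "transport (hamming (H - {e})) ((H - {e}) \<rightarrow>\<^sub>E {1..q})
    (unif (proper_edge_colorings (H - {e}) q (remove_color (remove_color K u a') w b)))
    (unif (proper_edge_colorings (H - {e}) q (remove_color (remove_color K u a') w b'))) D"
    using ex(2,3) K by (intro IH remove_color_subset)
  ultimately show "transport (hamming (H - {e})) ((H - {e}) \<rightarrow>\<^sub>E {1..q})
    (unif (proper_edge_colorings (H - {e}) q (remove_color (remove_color K u a) w b)))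
    (unif (proper_edge_colorings (H - {e}) q (remove_color (remove_color K u a') w b'))) (D + D)"
    using finite_colorings[OF fin'] hamming_triangle[OF fin'] by (intro transport_trans)
qed (rule ne proper_edge_colorings_subset hamming_fun_upd_le[OF fin])+

text \<open>Being extra is asked of the lists after deletion, the form in which
  \<open>extra_delete_edge\<close> passes it on to smaller edge sets. Lists, vertex and colors vary
  in the induction because recursive calls change a color at either end of a deleted edge.\<close>

lemma transport_remove_color:
  assumes "finite H" and "\<And>e. e \<in> H \<Longrightarrow> card e = 2" and "\<And>v. vertex_degree H v \<le> \<Delta>"
    and "\<And>e. e \<in> H \<Longrightarrow> L e \<subseteq> {1..q}"
    and "extra ((1 + \<epsilon>) * real \<Delta> + 1) H (remove_color L u a)"
    and "extra ((1 + \<epsilon>) * real \<Delta> + 1) H (remove_color L u b)"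
    and pos: "0 < \<epsilon>"
  shows "transport (hamming H) (H \<rightarrow>\<^sub>E {1..q}) (unif (proper_edge_colorings H q (remove_color L u a)))
    (unif (proper_edge_colorings H q (remove_color L u b))) (1 / \<epsilon>)"
  using assms(1-6)
proof (induction "card H" arbitrary: H L u a b rule: less_induct)
  case less
  note fin = less.prems(1) and card2 = less.prems(2) and deg = less.prems(3)
  define \<beta> where "\<beta> = (1 + \<epsilon>) * real \<Delta> + 1"
  let ?S = "H \<rightarrow>\<^sub>E {1..q}"
  let ?P = "proper_edge_colorings H q"
  let ?J = "{e \<in> H. u \<in> e}"
  have L: "remove_color L u c e \<subseteq> {1..q}" if "e \<in> H" for c e
    using less.prems(4) that by (intro remove_color_subset)
  have \<beta>: "1 \<le> \<beta>" using pos by (simp add: \<beta>_def)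
  have ne: "?P M \<noteq> {}" if "extra \<beta> H M" "\<And>e. e \<in> H \<Longrightarrow> M e \<subseteq> {1..q}" for M
  proof (rule proper_edge_colorings_nonempty[OF fin that(2)])
    fix e assume "e \<in> H"
    then show "edge_degree H e < card (M e)" using that(1) \<beta> by (force simp: extra_def)
  qed
  \<comment> \<open>The colors are generalized: later \<open>a\<close> and \<open>b\<close> are also
    exchanged, and \<open>c\<close> runs over the possible colors of \<open>e\<close> in the
    target.\<close>
  have pin: "transport (hamming H) ?S (unif {\<sigma> \<in> ?P (remove_color L u a). \<sigma> e = b})
      (unif {\<sigma> \<in> ?P (remove_color L u b). \<sigma> e = c}) (1 + 2 / \<epsilon>)"
    if e: "e \<in> ?J" and neX: "{\<sigma> \<in> ?P (remove_color L u a). \<sigma> e = b} \<noteq> {}"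
      and neY: "{\<sigma> \<in> ?P (remove_color L u b). \<sigma> e = c} \<noteq> {}"
      and ex: "extra \<beta> H (remove_color L u a)" "extra \<beta> H (remove_color L u b)" for a b c e
  proof -
    obtain w where w: "e = {u, w}" "u \<noteq> w"
      using card2[of e] e by (auto simp: card_2_iff)
    have eH: "e \<in> H" using e by simp
    have bc: "b \<in> remove_color L u a e" "c \<in> remove_color L u b e"
      using neX neY eH by (auto simp: proper_edge_colorings_def)
    then have bcq: "b \<in> {1..q}" "c \<in> {1..q}" using L[OF eH] by blast+
    \<comment> \<open>Pinning \<open>e\<close> to \<open>b\<close> on the left deletes
      \<open>b\<close> at \<open>u\<close> there too, so both sides can be written over lists
      without \<open>b\<close> at \<open>u\<close>.\<close>
    let ?K = "remove_color L u b"
    have X: "{\<sigma> \<in> ?P (remove_color L u a). \<sigma> e = b} = (\<lambda>\<tau>. \<tau>(e := b)) `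
        proper_edge_colorings (H - {e}) q (remove_color (remove_color ?K u a) w b)"
      using pinned_colorings_eq[where M = "remove_color L u a", OF eH w(1) bc(1) bcq(1)]
      by (simp only: remove_color_commute[of L u a u b])
    have Y: "{\<sigma> \<in> ?P ?K. \<sigma> e = c} = (\<lambda>\<tau>. \<tau>(e := c)) `
        proper_edge_colorings (H - {e}) q (remove_color (remove_color ?K u c) w c)"
      by (rule pinned_colorings_eq[where M = ?K, OF eH w(1) bc(2) bcq(2)])
    have smaller: "card (H - {e}) < card H"
      using fin eH by (meson card_Diff1_less)
    have deg': "vertex_degree (H - {e}) v \<le> \<Delta>" for v
    proof -
      have "vertex_degree (H - {e}) v \<le> vertex_degree H v"
        unfolding vertex_degree_def using fin by (intro card_mono) auto
      also note deg[of v]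
      finally show ?thesis .
    qed
    \<comment> \<open>Deleting \<open>e\<close>, the remaining lists differ from \<open>?K\<close> by \<open>a\<close> versus \<open>c\<close> at \<open>u\<close> and \<open>b\<close> versus \<open>c\<close> at \<open>w\<close>;
      the list sizes permit passing through the instance with \<open>c\<close> deleted at \<open>u\<close> and \<open>b\<close> at \<open>w\<close>.\<close>
    have "transport (hamming H) ?S (unif {\<sigma> \<in> ?P (remove_color L u a). \<sigma> e = b})
      (unif {\<sigma> \<in> ?P ?K. \<sigma> e = c}) (1 / \<epsilon> + 1 / \<epsilon> + 1)"
      unfolding X Y
    proof (rule transport_pinned[where \<beta> = \<beta>, OF fin eH bcq])
      show "?K f \<subseteq> {1..q}" if "f \<in> H - {e}" for f using L that by simp
      show "proper_edge_colorings (H - {e}) q (remove_color (remove_color ?K u a) w b) \<noteq> {}"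
        using neX unfolding X by blast
      show "extra \<beta> (H - {e}) (remove_color (remove_color ?K u a) w b)"
        unfolding remove_color_commute[of L u b u a]
        by (rule extra_delete_edge[OF fin card2 eH w ex(1)])
      show "extra \<beta> (H - {e}) (remove_color (remove_color ?K u c) w b)"
        by (rule extra_delete_edge[OF fin card2 eH w ex(2)])
      show "extra \<beta> (H - {e}) (remove_color (remove_color ?K u c) w c)"
        by (rule extra_delete_edge[OF fin card2 eH w ex(2)])
      fix K v a a'
      assume "\<And>f. f \<in> H - {e} \<Longrightarrow> K f \<subseteq> {1..q}" "extra \<beta> (H - {e}) (remove_color K v a)"
        "extra \<beta> (H - {e}) (remove_color K v a')"
      then show "transport (hamming (H - {e})) ((H - {e}) \<rightarrow>\<^sub>E {1..q})
        (unif (proper_edge_colorings (H - {e}) q (remove_color K v a)))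
        (unif (proper_edge_colorings (H - {e}) q (remove_color K v a'))) (1 / \<epsilon>)"
        unfolding \<beta>_def using fin card2 deg' by (intro less.hyps smaller) auto
    qed
    then show ?thesis by (rule transport_mono) simp
  qed
  have all: "transport (hamming H) ?S (unif {\<sigma> \<in> ?P (remove_color L u a). \<sigma> e = b})
      (unif (?P (remove_color L u b))) (1 + 2 / \<epsilon>)"
    if "e \<in> ?J" "{\<sigma> \<in> ?P (remove_color L u a). \<sigma> e = b} \<noteq> {}"
      "extra \<beta> H (remove_color L u a)" "extra \<beta> H (remove_color L u b)" for a b e
  proof (rule transport_fibers[where I = "{1..q}" and p = "\<lambda>\<sigma>. \<sigma> e"])
    show "\<sigma> e \<in> {1..q}" if "\<sigma> \<in> ?P (remove_color L u b)" for \<sigma>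
      using that \<open>e \<in> ?J\<close> unfolding proper_edge_colorings_def by auto
    show "?P (remove_color L u b) \<noteq> {}" by (rule ne[OF that(4) L])
    show "transport (hamming H) ?S (unif {\<sigma> \<in> ?P (remove_color L u a). \<sigma> e = b})
        (unif {\<sigma> \<in> ?P (remove_color L u b). \<sigma> e = c}) (1 + 2 / \<epsilon>)"
      if "{\<sigma> \<in> ?P (remove_color L u b). \<sigma> e = c} \<noteq> {}" for c
      by (rule pin[OF \<open>e \<in> ?J\<close> _ that]) fact+
  qed (rule finite_colorings[OF fin] proper_edge_colorings_subset finite_atLeastAtMost)+
  have ex: "extra \<beta> H (remove_color L u a)" "extra \<beta> H (remove_color L u b)"
    using less.prems unfolding \<beta>_def by auto
  \<comment> \<open>Since \<open>\<beta> - 1 = (1 + \<epsilon>) * real \<Delta>\<close> and at most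
    \<open>\<Delta>\<close> edges meet \<open>u\<close>, the recoloring count gives the smallness
    condition of \<open>transport_common_part\<close>.\<close>
  have small: "(1 + \<epsilon>) * real (card ?J) * real (card {\<sigma> \<in> ?P M. \<sigma> e = c}) \<le>
      real (card (?P (remove_color M u c)))"
    if "e \<in> ?J" "extra \<beta> H M" "\<And>f. f \<in> H \<Longrightarrow> M f \<subseteq> {1..q}" for e M c
  proof -
    have "real (card ?J) \<le> real \<Delta>"
      using deg[of u] unfolding vertex_degree_def by simp
    then have "(1 + \<epsilon>) * real (card ?J) \<le> \<beta> - 1"
      using pos unfolding \<beta>_def by simp
    then have "(1 + \<epsilon>) * real (card ?J) * real (card {\<sigma> \<in> ?P M. \<sigma> e = c}) \<le>
        (\<beta> - 1) * real (card {\<sigma> \<in> ?P M. \<sigma> e = c})"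
      by (rule mult_right_mono) simp
    also have "\<dots> \<le> real (card (?P (remove_color M u c)))"
      using that fin by (intro card_pinned_colorings_le) auto
    finally show ?thesis .
  qed
  have "transport (hamming H) ?S (unif (?P (remove_color L u a))) (unif (?P (remove_color L u b)))
    ((1 + 2 / \<epsilon>) / (2 + \<epsilon>))"
  proof (rule transport_common_part[where J = ?J and Z = "?P (remove_color (remove_color L u a) u b)"
        and X' = "\<lambda>e. {\<sigma> \<in> ?P (remove_color L u a). \<sigma> e = b}"
        and Y' = "\<lambda>e. {\<sigma> \<in> ?P (remove_color L u b). \<sigma> e = a}"])
    fix e assume e: "e \<in> ?J"
    show "(1 + \<epsilon>) * real (card ?J) * real (card {\<sigma> \<in> ?P (remove_color L u a). \<sigma> e = b}) \<le>
      real (card (?P (remove_color (remove_color L u a) u b)))"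
      by (rule small[OF e ex(1) L])
    show "(1 + \<epsilon>) * real (card ?J) * real (card {\<sigma> \<in> ?P (remove_color L u b). \<sigma> e = a}) \<le>
      real (card (?P (remove_color (remove_color L u a) u b)))"
      unfolding remove_color_commute[of L u a u b] by (rule small[OF e ex(2) L])
    assume Y': "{\<sigma> \<in> ?P (remove_color L u b). \<sigma> e = a} \<noteq> {}"
    show "transport (hamming H) ?S (unif (?P (remove_color L u a)))
        (unif {\<sigma> \<in> ?P (remove_color L u b). \<sigma> e = a}) (1 + 2 / \<epsilon>)"
      by (rule transport_sym[OF all[OF e Y' ex(2,1)] hamming_commute])
  next
    show "indicator (?P (remove_color L u a)) \<sigma> = indicator (?P (remove_color (remove_color L u a) u b)) \<sigma> +
      (\<Sum>e\<in>?J. indicator {\<sigma> \<in> ?P (remove_color L u a). \<sigma> e = b} \<sigma> :: real)" for \<sigma>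
      by (rule indicator_proper_edge_colorings_split[OF fin])
    show "indicator (?P (remove_color L u b)) \<sigma> = indicator (?P (remove_color (remove_color L u a) u b)) \<sigma> +
      (\<Sum>e\<in>?J. indicator {\<sigma> \<in> ?P (remove_color L u b). \<sigma> e = a} \<sigma> :: real)" for \<sigma>
      unfolding remove_color_commute[of L u a u b]
      by (rule indicator_proper_edge_colorings_split[OF fin])
    show "?P (remove_color L u a) \<noteq> {}" by (rule ne[OF ex(1) L])
    show "?P (remove_color L u b) \<noteq> {}" by (rule ne[OF ex(2) L])
    show "finite ?S" by (rule finite_colorings[OF fin])
    show "finite ?J" "0 < \<epsilon>" "0 \<le> 1 + 2 / \<epsilon>" using fin pos by auto
    show "?P (remove_color L u a) \<subseteq> ?S" "?P (remove_color L u b) \<subseteq> ?S"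
      by (simp_all only: proper_edge_colorings_subset)
  next
    fix e assume e: "e \<in> ?J" and X': "{\<sigma> \<in> ?P (remove_color L u a). \<sigma> e = b} \<noteq> {}"
    show "transport (hamming H) ?S (unif {\<sigma> \<in> ?P (remove_color L u a). \<sigma> e = b})
        (unif (?P (remove_color L u b))) (1 + 2 / \<epsilon>)"
      by (rule all[OF e X' ex])
    assume Y': "{\<sigma> \<in> ?P (remove_color L u b). \<sigma> e = a} \<noteq> {}"
    show "transport (hamming H) ?S (unif {\<sigma> \<in> ?P (remove_color L u a). \<sigma> e = b})
        (unif {\<sigma> \<in> ?P (remove_color L u b). \<sigma> e = a}) (1 + 2 / \<epsilon>)"
      by (rule pin[OF e X' Y' ex])
  qed (rule hamming_self)
  \<comment> \<open>The constant reproduces itself: \<open>D = 1 / \<epsilon>\<close> solves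
    \<open>(1 + 2 * D) / (2 + \<epsilon>) = D\<close>.\<close>
  moreover have "(1 + 2 / \<epsilon>) / (2 + \<epsilon>) = 1 / \<epsilon>"
  proof -
    have "1 + 2 / \<epsilon> = (2 + \<epsilon>) / \<epsilon>" using pos by (simp add: field_simps)
    then show ?thesis using pos by simp
  qed
  ultimately show ?case by simp
qed

section \<open>Pinned uniform distributions and the bound on their distance\<close>

lemma cond_pmf_pmf_of_set:
  assumes fin: "finite A" and ne: "A \<inter> B \<noteq> {}"
  shows "cond_pmf (pmf_of_set A) B = pmf_of_set (A \<inter> B)"
proof (rule pmf_eqI)
  fix x
  have A: "A \<noteq> {}" using ne by auto
  then have AB: "set_pmf (pmf_of_set A) \<inter> B \<noteq> {}"
    using fin ne by (simp add: set_pmf_of_set)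
  have "0 < card A" "0 < card (A \<inter> B)"
    using fin A ne by (simp_all add: card_gt_0_iff)
  then show "pmf (cond_pmf (pmf_of_set A) B) x = pmf (pmf_of_set (A \<inter> B)) x"
    using fin A ne by (simp add: pmf_cond[OF AB] measure_pmf_of_set indicator_def)
qed

theorem theorem4p2:
  fixes V :: "'v set" and E :: "'v set set" and q :: nat and L :: "'v set \<Rightarrow> nat set"
    and \<Delta> :: nat and \<epsilon> :: real and \<mu> :: "('v set \<Rightarrow> nat) pmf"
    and i :: "'v set" and a b :: nat
  assumes "\<Delta> \<ge> 1"
    and "\<epsilon> > 0"
    and "list_edge_coloring_instance V E q L"
    and "extra ((1 + \<epsilon>) * real \<Delta> + 1) E L"
    and "\<forall>v\<in>V. vertex_degree E v \<le> \<Delta>"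
    and "\<mu> = uniform_edge_coloring E q L"
    and "i \<in> E"
    and "a \<in> L i"
    and "b \<in> L i"
  shows "wasserstein1 (hamming E) (marginal (pinned \<mu> i a) E) (marginal (pinned \<mu> i b) E)
           \<le> 1 + 2 / \<epsilon>"
proof -
  let ?\<beta> = "(1 + \<epsilon>) * real \<Delta> + 1"
  let ?P = "\<lambda>c. {\<sigma> \<in> proper_edge_colorings E q L. \<sigma> i = c}"
  have EV: "E \<subseteq> Pow V" "finite V" and card2: "\<And>e. e \<in> E \<Longrightarrow> card e = 2"
    and L: "\<And>e. e \<in> E \<Longrightarrow> L e \<subseteq> {1..q}"
    using assms(3) by (auto simp: list_edge_coloring_instance_def finite_graph_def)
  then have fin: "finite E" by (meson finite_Pow_iff finite_subset)
  \<comment> \<open>The one-vertex estimate asks for the degree bound at every element of the vertex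
    type; outside \<open>V\<close> the degree is 0.\<close>
  have deg: "vertex_degree (E - {i}) v \<le> \<Delta>" for v
  proof (cases "v \<in> V")
    case True
    have "vertex_degree (E - {i}) v \<le> vertex_degree E v"
      unfolding vertex_degree_def using fin by (intro card_mono) auto
    with True assms(5) show ?thesis by (meson order_trans)
  next
    case False
    then have "{e \<in> E - {i}. v \<in> e} = {}" using EV by blast
    then show ?thesis by (simp only: vertex_degree_def card.empty)
  qed
  obtain u w where uw: "i = {u, w}" "u \<noteq> w"
    using card2[OF assms(7)] by (auto simp: card_2_iff)
  \<comment> \<open>Deleting \<open>i\<close> lowers the degree of its neighbors by one, which
    compensates for the color lost at \<open>u\<close> or \<open>w\<close>.\<close>
  have ex: "extra ?\<beta> (E - {i}) (remove_color (remove_color L u c) w c')" for c c'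
    by (rule extra_delete_edge[OF fin card2 assms(7) uw assms(4)])
  have ne: "proper_edge_colorings (E - {i}) q (remove_color (remove_color L u c) w c) \<noteq> {}" for c
  proof (rule proper_edge_colorings_nonempty)
    fix e assume e: "e \<in> E - {i}"
    have "0 \<le> (1 + \<epsilon>) * real \<Delta>" using assms(2) by simp
    then show "edge_degree (E - {i}) e < card (remove_color (remove_color L u c) w c e)"
      using ex[of c c] e by (force simp: extra_def)
    show "remove_color (remove_color L u c) w c e \<subseteq> {1..q}"
      using e L by (intro remove_color_subset) auto
  qed (use fin in simp)
  have pin: "?P c = (\<lambda>\<tau>. \<tau>(i := c)) `
      proper_edge_colorings (E - {i}) q (remove_color (remove_color L u c) w c)"
    if "c \<in> L i" for c
    using L[OF assms(7)] that by (intro pinned_colorings_eq assms(7) uw(1)) auto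
  have neP: "?P c \<noteq> {}" if "c \<in> L i" for c
    unfolding pin[OF that] using ne by blast
  have subS: "?P c \<subseteq> E \<rightarrow>\<^sub>E {1..q}" for c
    using proper_edge_colorings_subset by blast
  \<comment> \<open>The base lists are \<open>L\<close>, and the deleted color changes from
    \<open>a\<close> to \<open>b\<close> at both ends of \<open>i\<close>.\<close>
  have "transport (hamming E) (E \<rightarrow>\<^sub>E {1..q}) (unif (?P a)) (unif (?P b)) (1 / \<epsilon> + 1 / \<epsilon> + 1)"
    unfolding pin[OF assms(8)] pin[OF assms(9)]
  proof (rule transport_pinned[OF fin assms(7) _ _ _ ne ex ex ex])
    show "a \<in> {1..q}" "b \<in> {1..q}" using assms(7-9) L by blast+
    show "L f \<subseteq> {1..q}" if "f \<in> E - {i}" for f using that L by simp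
    fix K v a a'
    assume "\<And>f. f \<in> E - {i} \<Longrightarrow> K f \<subseteq> {1..q}" "extra ?\<beta> (E - {i}) (remove_color K v a)"
      "extra ?\<beta> (E - {i}) (remove_color K v a')"
    then show "transport (hamming (E - {i})) ((E - {i}) \<rightarrow>\<^sub>E {1..q})
        (unif (proper_edge_colorings (E - {i}) q (remove_color K v a)))
        (unif (proper_edge_colorings (E - {i}) q (remove_color K v a'))) (1 / \<epsilon>)"
      using fin card2 deg assms(2) by (intro transport_remove_color) auto
  qed
  then have tr: "transport (hamming E) (E \<rightarrow>\<^sub>E {1..q}) (unif (?P a)) (unif (?P b)) (1 + 2 / \<epsilon>)"
    by (rule transport_mono) simp
  \<comment> \<open>Conditioning keeps the distribution uniform, now on the pinned colorings; these
    are extensional on \<open>E\<close>, so restriction to \<open>E\<close> fixes them.\<close>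
  have marg: "marginal (pinned \<mu> i c) E = pmf_of_set (?P c)" if "c \<in> L i" for c
  proof -
    have finP: "finite (proper_edge_colorings E q L)"
      by (rule finite_proper_edge_colorings[OF fin])
    have eq: "proper_edge_colorings E q L \<inter> {\<sigma>. \<sigma> i = c} = ?P c" by blast
    have "pinned \<mu> i c = pmf_of_set (?P c)"
      unfolding pinned_def assms(6) uniform_edge_coloring_def
      using neP[OF that] cond_pmf_pmf_of_set[OF finP, of "{\<sigma>. \<sigma> i = c}"] unfolding eq by blast
    moreover have "map_pmf (\<lambda>\<sigma>. restrict \<sigma> E) (pmf_of_set (?P c)) = map_pmf (\<lambda>\<sigma>. \<sigma>) (pmf_of_set (?P c))"
    proof (rule map_pmf_cong[OF refl])
      fix \<sigma> assume "\<sigma> \<in> set_pmf (pmf_of_set (?P c))"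
      then have "\<sigma> \<in> ?P c" using neP[OF that] finP by (simp add: set_pmf_of_set)
      then show "restrict \<sigma> E = \<sigma>"
        using subS[of c] by (meson PiE_restrict subsetD)
    qed
    ultimately show ?thesis by (simp add: marginal_def)
  qed
  show ?thesis
    unfolding marg[OF assms(8)] marg[OF assms(9)]
    using finite_colorings[OF fin] subS neP assms(8,9) tr
    by (intro transport_imp_wasserstein1_le) (auto simp: hamming_def simp del: Collect_empty_eq One_nat_def)
qed

end
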